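(* Let $p$ be an odd prime and let $k\in\mathbb{F}_p$ be a non-square, so that $\mathbb{F}_p[t]/(t^2-k)\cong\mathbb{F}_{p^2}$. Up to cohomologous (that is, up to multiplication by a coboundary), every $2$-cocycle $\alpha$ of $\mathbb{H}_{3}\big(\mathbb{F}_p[t]/(t^2-k)\big)$ with values in $\mathbb{C}^\times$ is of the following form: $$\alpha\big(x_1^{a_1}x_2^{a_2}y_1^{b_1}y_2^{b_2}z_1^{c_1}z_2^{c_2},\, x_1^{a_1'}x_2^{a_2'}y_1^{b_1'}y_2^{b_2'}z_1^{c_1'}z_2^{c_2'}\big)=\mu_1^{a_2a_1'}\, \mu_2^{b_2a_1'}\,\mu_3^{b_2a_2'}\, \mu_4^{b_2 b_1'}\, \mu_5^{q_5}\, \mu_6^{q_6}\, \mu_7^{q_7}\, \mu_8^{q_8},$$ where $\mu_i \in \mathbb{C}^\times$ satisfy $\mu_i^p=1$ for $1\le i\le 8$, and $$q_5=b_1\tbinom{a_1'}{2}+kb_1\tbinom{a_2'}{2}+ kb_2a_1'a_2'+a_1'c_1+ka_2'c_2,$$ $$q_6=b_2\tbinom{a_1'}{2}+kb_2\tbinom{a_2'}{2}+b_1a_1'a_2'+a_1'c_2+a_2'c_1,$$ $$q_7=a_1'\tbinom{b_1}{2}+ka_1'\tbinom{b_2}{2}-b_1^2a_1'-b_1c_1'-kb_2c_2',$$ $$q_8=a_2'\tbinom{b_1}{2}+ka_2'\tbinom{b_2}{2}-kb_2^2a_2'-b_2c_1'-b_1c_2'.$$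
   Context: $\mathbb{H}_3(R)$ is the group of upper unitriangular $3\times 3$ matrices over the commutative ring $R$. For $R=\mathbb{F}_p[t]/(t^2-k)$, write $r_1+r_2t\in R$ as $(r_1,r_2)$ with $r_1,r_2\in\mathbb{F}_p$. The symbol $x_1^{a_1}x_2^{a_2}y_1^{b_1}y_2^{b_2}z_1^{c_1}z_2^{c_2}$ (with $a_i,b_i,c_i\in\mathbb{F}_p$) denotes the matrix $\begin{pmatrix}1&(b_1,b_2)&(c_1,c_2)\\0&1&(a_1,a_2)\\0&0&1\end{pmatrix}$. $\binom{a}{2}=a(a-1)/2$, computed in $\mathbb{F}_p$. 2-cocycles are for the trivial action of the group on $\mathbb{C}^\times$.
   Formalization: The printed q_7 and q_8 violate the 2-cocycle identity, so the claim as printed fails; it is proved with the extra terms −k b_2^2 a_1' − k b_1 b_2 a_2' added to q_7 and −b_1^2 a_2' − b_1 b_2 a_1' added to q_8. *)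

theory Defs
  imports
    Complex_Main
    "HOL-Algebra.QuotRing"
    "Jordan_Normal_Form.VS_Connect"
    "Berlekamp_Zassenhaus.Finite_Field"
begin

text \<open>
  The ring need not be a type-class ring, so matrix multiplication is written with the
  operations of the given ring record.
\<close>

definition mat3 :: "'r \<Rightarrow> 'r \<Rightarrow> 'r \<Rightarrow> 'r \<Rightarrow> 'r \<Rightarrow> 'r \<Rightarrow> 'r \<Rightarrow> 'r \<Rightarrow> 'r \<Rightarrow> 'r mat" where
  "mat3 m00 m01 m02 m10 m11 m12 m20 m21 m22 =
     mat 3 3 (\<lambda>(i, j). [[m00, m01, m02], [m10, m11, m12], [m20, m21, m22]] ! i ! j)"

definition mat_mult3 :: "('r, 'm) ring_scheme \<Rightarrow> 'r mat \<Rightarrow> 'r mat \<Rightarrow> 'r mat" where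
  "mat_mult3 R A B =
     mat 3 3 (\<lambda>(i, j). \<Oplus>\<^bsub>R\<^esub>l\<in>{..<3}. (A $$ (i, l)) \<otimes>\<^bsub>R\<^esub> (B $$ (l, j)))"

definition unitriangular3 :: "('r, 'm) ring_scheme \<Rightarrow> 'r mat set" where
  "unitriangular3 R =
     {A \<in> carrier_mat 3 3.
        (\<forall>i<3. \<forall>j<3. A $$ (i, j) \<in> carrier R) \<and>
        (\<forall>i<3. A $$ (i, i) = \<one>\<^bsub>R\<^esub>) \<and>
        (\<forall>i<3. \<forall>j<i. A $$ (i, j) = \<zero>\<^bsub>R\<^esub>)}"

definition heisenberg :: "('r, 'm) ring_scheme \<Rightarrow> 'r mat monoid" where
  "heisenberg R =
     \<lparr>carrier = unitriangular3 R,
      monoid.mult = mat_mult3 R,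
      one = mat3 \<one>\<^bsub>R\<^esub> \<zero>\<^bsub>R\<^esub> \<zero>\<^bsub>R\<^esub> \<zero>\<^bsub>R\<^esub> \<one>\<^bsub>R\<^esub> \<zero>\<^bsub>R\<^esub> \<zero>\<^bsub>R\<^esub> \<zero>\<^bsub>R\<^esub> \<one>\<^bsub>R\<^esub>\<rparr>"


text \<open>
  The prime field is \<open>'p mod_ring\<close> with \<open>p = CARD('p)\<close>; class \<open>prime_card\<close> says that
  \<open>CARD('p)\<close> is prime.
\<close>

definition quad_ideal :: "'p::prime_card mod_ring \<Rightarrow> 'p mod_ring poly set" where
  "quad_ideal k = PIdl\<^bsub>class_ring\<^esub> [:- k, 0, 1:]"

definition quad_ring :: "'p::prime_card mod_ring \<Rightarrow> 'p mod_ring poly set ring" where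
  "quad_ring k = class_ring Quot quad_ideal k"

text \<open>\<open>quad_elt k r1 r2\<close> is the element $r_1 + r_2 t$, i.e.\ the pair $(r_1, r_2)$.\<close>

definition quad_elt ::
    "'p::prime_card mod_ring \<Rightarrow> 'p mod_ring \<Rightarrow> 'p mod_ring \<Rightarrow> 'p mod_ring poly set" where
  "quad_elt k r1 r2 = quad_ideal k +>\<^bsub>class_ring\<^esub> [:r1, r2:]"

text \<open>\<open>heis_elt k a1 a2 b1 b2 c1 c2\<close> is
  $x_1^{a_1}x_2^{a_2}y_1^{b_1}y_2^{b_2}z_1^{c_1}z_2^{c_2}$; note that \<open>a\<close> sits in the last
  column and \<open>b\<close> in the first row.\<close>

definition heis_elt ::
    "'p::prime_card mod_ring \<Rightarrow> 'p mod_ring \<Rightarrow> 'p mod_ring \<Rightarrow> 'p mod_ring \<Rightarrow> 'p mod_ring \<Rightarrow>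
     'p mod_ring \<Rightarrow> 'p mod_ring \<Rightarrow> 'p mod_ring poly set mat" where
  "heis_elt k a1 a2 b1 b2 c1 c2 =
     mat3 (quad_elt k 1 0) (quad_elt k b1 b2) (quad_elt k c1 c2)
          (quad_elt k 0 0) (quad_elt k 1 0)   (quad_elt k a1 a2)
          (quad_elt k 0 0) (quad_elt k 0 0)   (quad_elt k 1 0)"


definition two_cocycle :: "('g, 'm) monoid_scheme \<Rightarrow> ('g \<Rightarrow> 'g \<Rightarrow> complex) \<Rightarrow> bool" where
  "two_cocycle G \<alpha> \<longleftrightarrow>
     (\<forall>x\<in>carrier G. \<forall>y\<in>carrier G. \<alpha> x y \<noteq> 0) \<and>
     (\<forall>x\<in>carrier G. \<forall>y\<in>carrier G. \<forall>z\<in>carrier G.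
        \<alpha> x y * \<alpha> (x \<otimes>\<^bsub>G\<^esub> y) z = \<alpha> x (y \<otimes>\<^bsub>G\<^esub> z) * \<alpha> y z)"

definition two_coboundary :: "('g, 'm) monoid_scheme \<Rightarrow> ('g \<Rightarrow> 'g \<Rightarrow> complex) \<Rightarrow> bool" where
  "two_coboundary G \<delta> \<longleftrightarrow>
     (\<exists>f. (\<forall>x\<in>carrier G. f x \<noteq> (0::complex)) \<and>
          (\<forall>x\<in>carrier G. \<forall>y\<in>carrier G. \<delta> x y = f x * f y / f (x \<otimes>\<^bsub>G\<^esub> y)))"

definition cohomologous ::
    "('g, 'm) monoid_scheme \<Rightarrow> ('g \<Rightarrow> 'g \<Rightarrow> complex) \<Rightarrow> ('g \<Rightarrow> 'g \<Rightarrow> complex) \<Rightarrow> bool" where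
  "cohomologous G \<alpha> \<beta> \<longleftrightarrow>
     (\<exists>\<delta>. two_coboundary G \<delta> \<and>
          (\<forall>x\<in>carrier G. \<forall>y\<in>carrier G. \<alpha> x y = \<beta> x y * \<delta> x y))"


definition binom2 :: "'p::prime_card mod_ring \<Rightarrow> 'p mod_ring" where
  "binom2 a = a * (a - 1) / 2"

text \<open>
  The classification uses the exponents $q_7$ and $q_8$ with two monomials each that are
  missing in the published formula,
  $-k b_2^2 a_1' - k b_1 b_2 a_2'$ and $-b_1^2 a_2' - b_1 b_2 a_1'$ respectively. Without them
  the exponents do not satisfy the cocycle identity: the coboundary of $q_7$ would be
  $2 k b_2 b_2' a_1'' + k (b_1 b_2' + b_2 b_1') a_2''$ and that of $q_8$ would be
  $2 b_1 b_1' a_2'' + (b_1 b_2' + b_2 b_1') a_1''$. The completion is unique up to terms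
  bilinear in $b$ and $a'$.
\<close>

text \<open>Exponents in $\mathbb{F}_p$ are evaluated at their representative in $\{0,\dots,p-1\}$;
  for \<open>\<mu> ^ CARD('p) = 1\<close> the choice of representative is immaterial.\<close>

definition fpow :: "complex \<Rightarrow> 'p::prime_card mod_ring \<Rightarrow> complex" (infixr "^\<^sub>p" 80) where
  "\<mu> ^\<^sub>p a = \<mu> ^ nat (to_int_mod_ring a)"

end

theory Submission
  imports Defs "HOL-Library.Product_Plus"
begin

text \<open>
  Write $R$ for the quotient ring and $G$ for the Heisenberg group, so an element of $G$ is a triple
  $(a, b, c)$ over $R$ with product $(a + a', b + b', c + c' + b a')$. A cocycle $\<alpha>$ is the factor
  set of a central extension $E$ of $G$ by the nonzero complex numbers; for commuting $x, y$ the
  quotient $\<alpha>(x,y) / \<alpha>(y,x)$ is the commutator in $E$ of lifts of $x$ and $y$.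

  The commutators of lifts of a central $c$ with lifts of $(a, b, d)$ are multiplicative in both
  arguments, so they depend only on $a$, $b$ and $c$. Conjugation in $E$ preserves the commutators of
  the abelian normal subgroup of triples with $b = 0$, which forces the part that depends on $a$ to
  be a function of $c a$; likewise for $b$ and $b c$. Hence they are $\<phi>(c a) \<psi>(b c)$ for two characters of $R$
  (\<open>central_commutators\<close>). The exponents $q_5, q_6$ are the coordinates of the $R$-valued cocycle
  $c a' + b \binom{a'}{2}$, and $q_7, q_8$ those of $-b c' - b^2 a' / 2$, up to bilinear terms. Their
  images under $\<phi>$ and $\<psi>$ have the same central commutators as $\<alpha>$, so dividing by
  them makes the lifts of the centre central in $E$.

  Cocycles of a cyclic group of prime order are coboundaries because complex numbers have $p$-th
  roots, and a Kuenneth argument reduces elementary abelian groups to that case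
  (\<open>cocycle_kuenneth\<close>). So the centre of $G$ lifts homomorphically to $E$, the lift can be divided
  out, and the remaining cocycle is inflated from $G$ modulo its centre, which is $R \times R$
  (\<open>cohom_inflation\<close>). There every cocycle is cohomologous to a product of characters of
  $a_2 a_1'$, $b_2 b_1'$ and the four products $b_i a_j'$. The characters of the coordinates of $c$
  have coboundaries that express $b_1 a_1'$ and $b_1 a_2'$ by $b_2 a_2'$ and $b_2 a_1'$, which leaves
  the four exponents of $\<mu>_1, \<dots>, \<mu>_4$.
\<close>

section \<open>Cocycles and cohomology\<close>

definition cocycle :: "('g \<Rightarrow> 'g \<Rightarrow> 'g) \<Rightarrow> ('g \<Rightarrow> 'g \<Rightarrow> complex) \<Rightarrow> bool" where
  "cocycle m \<alpha> \<longleftrightarrow> (\<forall>x y. \<alpha> x y \<noteq> 0) \<and>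
     (\<forall>x y z. \<alpha> x y * \<alpha> (m x y) z = \<alpha> x (m y z) * \<alpha> y z)"

text \<open>
  The two factor sets describe equivalent extensions: rescaling the lift of each $x$ by $u(x)$ turns
  the first into the second.
\<close>

definition cohom ::
    "('g \<Rightarrow> 'g \<Rightarrow> 'g) \<Rightarrow> ('g \<Rightarrow> 'g \<Rightarrow> complex) \<Rightarrow> ('g \<Rightarrow> 'g \<Rightarrow> complex) \<Rightarrow> bool" where
  "cohom m \<alpha> \<beta> \<longleftrightarrow> (\<exists>u. (\<forall>x. u x \<noteq> 0) \<and>
     (\<forall>x y. \<alpha> x y * (u x * u y) = \<beta> x y * u (m x y)))"

lemma cocycle_nonzero: "cocycle m \<alpha> \<Longrightarrow> \<alpha> x y \<noteq> 0"
  by (simp add: cocycle_def)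

lemma cocycle_eq: "cocycle m \<alpha> \<Longrightarrow> \<alpha> x y * \<alpha> (m x y) z = \<alpha> x (m y z) * \<alpha> y z"
  by (simp add: cocycle_def)

lemma cohomE:
  assumes "cohom m \<alpha> \<beta>"
  obtains u where "\<And>x. u x \<noteq> 0" "\<And>x y. \<alpha> x y * (u x * u y) = \<beta> x y * u (m x y)"
  using assms unfolding cohom_def by blast

lemma cohom_trans:
  assumes "cohom m \<alpha> \<beta>" "cohom m \<beta> \<gamma>"
  shows "cohom m \<alpha> \<gamma>"
proof -
  obtain u where u: "\<And>x. u x \<noteq> 0" "\<And>x y. \<alpha> x y * (u x * u y) = \<beta> x y * u (m x y)"
    using cohomE[OF assms(1)] by blast
  obtain v where v: "\<And>x. v x \<noteq> 0" "\<And>x y. \<beta> x y * (v x * v y) = \<gamma> x y * v (m x y)"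
    using cohomE[OF assms(2)] by blast
  have "\<alpha> x y * ((u x * v x) * (u y * v y)) = \<gamma> x y * (u (m x y) * v (m x y))" for x y
  proof -
    have "\<alpha> x y * ((u x * v x) * (u y * v y)) = \<alpha> x y * (u x * u y) * (v x * v y)"
      by (simp only: mult_ac)
    also have "\<dots> = \<beta> x y * (v x * v y) * u (m x y)"
      unfolding u(2) by (simp only: mult_ac)
    also have "\<dots> = \<gamma> x y * (u (m x y) * v (m x y))"
      unfolding v(2) by (simp only: mult_ac)
    finally show ?thesis .
  qed
  then show ?thesis
    unfolding cohom_def using u(1) v(1) by (intro exI[of _ "\<lambda>x. u x * v x"]) auto
qed

lemma cohom_refl: "cohom m \<alpha> \<alpha>"
  unfolding cohom_def by (intro exI[of _ "\<lambda>_. 1"]) auto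

lemma cohom_cong_right:
  assumes "cohom m \<alpha> \<beta>" "\<And>x y. \<beta> x y = \<beta>' x y"
  shows "cohom m \<alpha> \<beta>'"
  using assms unfolding cohom_def by simp

lemma cohom_mult:
  assumes "cohom m \<alpha> \<beta>" "cohom m \<alpha>' \<beta>'"
  shows "cohom m (\<lambda>x y. \<alpha> x y * \<alpha>' x y) (\<lambda>x y. \<beta> x y * \<beta>' x y)"
proof -
  obtain u where u: "\<And>x. u x \<noteq> 0" "\<And>x y. \<alpha> x y * (u x * u y) = \<beta> x y * u (m x y)"
    using cohomE[OF assms(1)] by blast
  obtain v where v: "\<And>x. v x \<noteq> 0" "\<And>x y. \<alpha>' x y * (v x * v y) = \<beta>' x y * v (m x y)"
    using cohomE[OF assms(2)] by blast
  have "\<alpha> x y * \<alpha>' x y * ((u x * v x) * (u y * v y))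
      = (\<alpha> x y * (u x * u y)) * (\<alpha>' x y * (v x * v y))" for x y
    by (simp only: mult_ac)
  then have "\<alpha> x y * \<alpha>' x y * ((u x * v x) * (u y * v y))
      = \<beta> x y * \<beta>' x y * (u (m x y) * v (m x y))" for x y
    unfolding u(2) v(2) by (simp only: mult_ac)
  then show ?thesis
    unfolding cohom_def using u(1) v(1) by (intro exI[of _ "\<lambda>x. u x * v x"]) auto
qed

lemma cocycle_mult:
  assumes "cocycle m \<alpha>" "cocycle m \<beta>"
  shows "cocycle m (\<lambda>x y. \<alpha> x y * \<beta> x y)"
  unfolding cocycle_def
proof (intro conjI allI)
  show "\<alpha> x y * \<beta> x y \<noteq> 0" for x y using assms by (simp add: cocycle_nonzero)
  have "\<alpha> x y * \<beta> x y * (\<alpha> (m x y) z * \<beta> (m x y) z)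
      = (\<alpha> x y * \<alpha> (m x y) z) * (\<beta> x y * \<beta> (m x y) z)" for x y z
    by (simp only: mult_ac)
  then show "\<alpha> x y * \<beta> x y * (\<alpha> (m x y) z * \<beta> (m x y) z)
      = \<alpha> x (m y z) * \<beta> x (m y z) * (\<alpha> y z * \<beta> y z)" for x y z
    unfolding cocycle_eq[OF assms(1)] cocycle_eq[OF assms(2)] by (simp only: mult_ac)
qed

lemma cocycle_divide:
  assumes "cocycle m \<alpha>" "cocycle m \<beta>"
  shows "cocycle m (\<lambda>x y. \<alpha> x y / \<beta> x y)"
  using assms unfolding cocycle_def by (auto simp: times_divide_times_eq)

text \<open>
  The factor set of the same extension for another choice of lifts.
\<close>

lemma cocycle_cohom:
  assumes \<alpha>: "cocycle m \<alpha>" and assoc: "\<And>x y z. m (m x y) z = m x (m y z)"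
    and u: "\<And>x. u x \<noteq> 0"
  shows "cocycle m (\<lambda>x y. \<alpha> x y * (u x * u y) / u (m x y))"
  unfolding cocycle_def
proof (intro conjI allI)
  fix x y z
  have "\<alpha> x y * (u x * u y) / u (m x y) * (\<alpha> (m x y) z * (u (m x y) * u z) / u (m (m x y) z))
    = \<alpha> x y * \<alpha> (m x y) z * (u x * u y * u z / u (m (m x y) z))"
    by (simp add: u)
  also have "\<dots> = \<alpha> x (m y z) * \<alpha> y z * (u x * u y * u z / u (m x (m y z)))"
    by (simp add: cocycle_eq[OF \<alpha>] assoc)
  also have "\<dots> = \<alpha> x (m y z) * (u x * u (m y z)) / u (m x (m y z)) * (\<alpha> y z * (u y * u z) / u (m y z))"
    by (simp add: u)
  finally show "\<alpha> x y * (u x * u y) / u (m x y) * (\<alpha> (m x y) z * (u (m x y) * u z) / u (m (m x y) z))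
    = \<alpha> x (m y z) * (u x * u (m y z)) / u (m x (m y z)) * (\<alpha> y z * (u y * u z) / u (m y z))" .
qed (use u cocycle_nonzero[OF \<alpha>] in auto)

lemma cocycle_pullback:
  assumes "cocycle m \<alpha>" "\<And>x y. f (n x y) = m (f x) (f y)"
  shows "cocycle n (\<lambda>x y. \<alpha> (f x) (f y))"
  using assms unfolding cocycle_def by simp

lemma cohom_pullback:
  assumes "cohom m \<alpha> \<beta>" "\<And>x y. f (n x y) = m (f x) (f y)"
  shows "cohom n (\<lambda>x y. \<alpha> (f x) (f y)) (\<lambda>x y. \<beta> (f x) (f y))"
proof -
  obtain u where "\<And>x. u x \<noteq> 0" "\<And>x y. \<alpha> x y * (u x * u y) = \<beta> x y * u (m x y)"
    using cohomE[OF assms(1)] by blast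
  then show ?thesis
    unfolding cohom_def by (intro exI[of _ "\<lambda>x. u (f x)"]) (simp add: assms(2))
qed

section \<open>Commutators in a central extension\<close>

text \<open>
  For commuting $x$ and $y$ this is the commutator of their lifts to the central extension, and it
  does not depend on the choice of the lifts.
\<close>

definition comm_pairing :: "('g \<Rightarrow> 'g \<Rightarrow> complex) \<Rightarrow> 'g \<Rightarrow> 'g \<Rightarrow> complex" where
  "comm_pairing \<alpha> x y = \<alpha> x y / \<alpha> y x"

text \<open>
  In the extension the commutators of a lift of $z$ with lifts of $g$ and $h$ are central, and a
  commutator $[z, g h]$ is the product of $[z, g]$ and the conjugate of $[z, h]$ by $g$.
\<close>

lemma comm_pairing_mult_right:
  assumes \<alpha>: "cocycle m \<alpha>" and c: "m z g = m g z" "m z h = m h z"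
  shows "comm_pairing \<alpha> z (m g h) = comm_pairing \<alpha> z g * comm_pairing \<alpha> z h"
proof -
  note nz = cocycle_nonzero[OF \<alpha>]
  have 1: "\<alpha> z (m g h) = \<alpha> z g * \<alpha> (m g z) h / \<alpha> g h"
    using cocycle_eq[OF \<alpha>, of z g h] c nz by (simp add: field_simps)
  have 2: "\<alpha> (m g h) z = \<alpha> g (m z h) * \<alpha> h z / \<alpha> g h"
    using cocycle_eq[OF \<alpha>, of g h z] c nz by (simp add: field_simps)
  have 3: "\<alpha> (m g z) h = \<alpha> g (m z h) * \<alpha> z h / \<alpha> g z"
    using cocycle_eq[OF \<alpha>, of g z h] nz by (simp add: field_simps)
  show ?thesis
    unfolding comm_pairing_def 1 2 3 using nz by simp
qed

lemma comm_pairing_swap: "comm_pairing \<alpha> y x = inverse (comm_pairing \<alpha> x y)"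
  by (simp add: comm_pairing_def)

lemma comm_pairing_mult_left:
  assumes "cocycle m \<alpha>" and "m z g = m g z" "m z h = m h z"
  shows "comm_pairing \<alpha> (m g h) z = comm_pairing \<alpha> g z * comm_pairing \<alpha> h z"
  using comm_pairing_mult_right[OF assms]
  by (simp add: comm_pairing_swap[of \<alpha> z] flip: inverse_mult_distrib)

lemma comm_pairing_nonzero: "cocycle m \<alpha> \<Longrightarrow> comm_pairing \<alpha> x y \<noteq> 0"
  by (simp add: comm_pairing_def cocycle_nonzero)

text \<open>
  With $x' = g x g^{-1}$ and $y' = g y g^{-1}$: conjugation fixes the commutator because it is central in
  the extension. Writing the relation as $x' g = g x$ avoids inverses.
\<close>

lemma comm_pairing_conj:
  assumes \<alpha>: "cocycle m \<alpha>"
    and xy: "m x y = m y x" "m x' y' = m y' x'"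
    and conj: "m x' g = m g x" "m y' g = m g y"
  shows "comm_pairing \<alpha> x' y' = comm_pairing \<alpha> x y"
proof -
  note nz = cocycle_nonzero[OF \<alpha>]
  \<comment> \<open>Apart from the factor $\<alpha>(x, y)$, the right-hand side is unchanged when the two pairs are swapped.\<close>
  have *: "\<alpha> x' y' = \<alpha> y' g * \<alpha> x' g * \<alpha> g (m x y) * \<alpha> x y / (\<alpha> g y * \<alpha> g x * \<alpha> (m x' y') g)"
    if "m x' g = m g x" "m y' g = m g y" for x y x' y'
  proof -
    have "\<alpha> x' y' = \<alpha> x' (m g y) * \<alpha> y' g / \<alpha> (m x' y') g"
      using cocycle_eq[OF \<alpha>, of x' y' g] that nz by (simp add: field_simps)
    moreover have "\<alpha> x' (m g y) = \<alpha> x' g * \<alpha> (m g x) y / \<alpha> g y"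
      using cocycle_eq[OF \<alpha>, of x' g y] that nz by (simp add: field_simps)
    moreover have "\<alpha> (m g x) y = \<alpha> g (m x y) * \<alpha> x y / \<alpha> g x"
      using cocycle_eq[OF \<alpha>, of g x y] nz by (simp add: field_simps)
    ultimately show ?thesis by (simp add: field_simps)
  qed
  show ?thesis
    unfolding comm_pairing_def *[OF conj] *[OF conj(2,1)] xy
    using nz by (simp add: field_simps)
qed

section \<open>Characters and products of abelian groups\<close>

definition character :: "('a::ab_group_add \<Rightarrow> complex) \<Rightarrow> bool" where
  "character \<phi> \<longleftrightarrow> (\<forall>x. \<phi> x \<noteq> 0) \<and> (\<forall>x y. \<phi> (x + y) = \<phi> x * \<phi> y)"

lemma character_nonzero: "character \<phi> \<Longrightarrow> \<phi> x \<noteq> 0"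
  by (simp add: character_def)

lemma character_add: "character \<phi> \<Longrightarrow> \<phi> (x + y) = \<phi> x * \<phi> y"
  by (simp add: character_def)

lemma character_zero: "character \<phi> \<Longrightarrow> \<phi> 0 = 1"
  using character_add[of \<phi> 0 0] character_nonzero[of \<phi> 0] by simp

lemma character_minus: "character \<phi> \<Longrightarrow> \<phi> (- x) = inverse (\<phi> x)"
  using character_add[of \<phi> x "- x"] character_zero[of \<phi>] inverse_unique[of "\<phi> x" "\<phi> (-x)"] by simp

lemma cocycle_character:
  assumes \<phi>: "character \<phi>"
    and Q: "\<And>x y z. Q x y + Q (m x y) z = Q x (m y z) + Q y z"
  shows "cocycle m (\<lambda>x y. \<phi> (Q x y))"
  unfolding cocycle_def
  by (simp add: character_nonzero[OF \<phi>]) (simp only: Q simp_thms flip: character_add[OF \<phi>])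

text \<open>
  The Kuenneth decomposition: lift $(a, b)$ by the product of the lifts of $(a, 0)$ and $(0, b)$. To
  multiply two such lifts, the lift of $(0, b)$ has to pass the lift of $(a', 0)$, which costs their
  commutator; what remains are products inside the two factors.
\<close>

lemma cocycle_kuenneth:
  fixes \<alpha> :: "'a::ab_group_add \<times> 'b::ab_group_add \<Rightarrow> 'a \<times> 'b \<Rightarrow> complex"
  assumes \<alpha>: "cocycle (+) \<alpha>"
  shows "cohom (+) \<alpha> (\<lambda>x y. \<alpha> (fst x, 0) (fst y, 0) * \<alpha> (0, snd x) (0, snd y) *
           comm_pairing \<alpha> (0, snd x) (fst y, 0))"
proof -
  note nz = cocycle_nonzero[OF \<alpha>]
  let ?u = "\<lambda>x. \<alpha> (fst x, 0) (0, snd x)"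
  have "\<alpha> (a, b) (a', b') * (?u (a, b) * ?u (a', b'))
      = \<alpha> (a, 0) (a', 0) * \<alpha> (0, b) (0, b') * comm_pairing \<alpha> (0, b) (a', 0) * ?u (a + a', b + b')"
    for a b a' b'
  proof -
    have 1: "\<alpha> (a, b) (a', b') = \<alpha> (a, 0) (a', b + b') * \<alpha> (0, b) (a', b') / \<alpha> (a, 0) (0, b)"
      using cocycle_eq[OF \<alpha>, of "(a, 0)" "(0, b)" "(a', b')"] nz by (simp add: field_simps)
    have 2: "\<alpha> (0, b) (a', b') = \<alpha> (0, b) (a', 0) * \<alpha> (a', b) (0, b') / \<alpha> (a', 0) (0, b')"
      using cocycle_eq[OF \<alpha>, of "(0, b)" "(a', 0)" "(0, b')"] nz by (simp add: field_simps)
    have 3: "\<alpha> (a', b) (0, b') = \<alpha> (a', 0) (0, b + b') * \<alpha> (0, b) (0, b') / \<alpha> (a', 0) (0, b)"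
      using cocycle_eq[OF \<alpha>, of "(a', 0)" "(0, b)" "(0, b')"] nz by (simp add: field_simps)
    have 4: "\<alpha> (a, 0) (a', b + b') = \<alpha> (a, 0) (a', 0) * \<alpha> (a + a', 0) (0, b + b') / \<alpha> (a', 0) (0, b + b')"
      using cocycle_eq[OF \<alpha>, of "(a, 0)" "(a', 0)" "(0, b + b')"] nz by (simp add: field_simps)
    show ?thesis
      unfolding 1 2 3 4 comm_pairing_def using nz by (simp add: field_simps)
  qed
  then show ?thesis
    unfolding cohom_def by (intro exI[of _ ?u]) (auto simp: nz)
qed

lemma character_pairing_left:
  fixes \<alpha> :: "'a::ab_group_add \<times> 'b::ab_group_add \<Rightarrow> 'a \<times> 'b \<Rightarrow> complex"
  assumes "cocycle (+) \<alpha>"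
  shows "character (\<lambda>b. comm_pairing \<alpha> (0, b) x)"
  using comm_pairing_mult_left[OF assms, of x "(0, _)" "(0, _)"] comm_pairing_nonzero[OF assms]
  by (simp add: character_def add.commute)

lemma character_pairing_right:
  fixes \<alpha> :: "'a::ab_group_add \<times> 'b::ab_group_add \<Rightarrow> 'a \<times> 'b \<Rightarrow> complex"
  assumes "cocycle (+) \<alpha>"
  shows "character (\<lambda>a. comm_pairing \<alpha> x (a, 0))"
  using comm_pairing_mult_right[OF assms, of x "(_, 0)" "(_, 0)"] comm_pairing_nonzero[OF assms]
  by (simp add: character_def add.commute)

section \<open>Heisenberg groups of a unital product\<close>

text \<open>
  The intended instance is a unital ring. Biadditivity makes the triples a group, and the unit
  writes every $c$ as $c \cdot 1$ and as $1 \cdot c$, hence every central element as a commutator.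
\<close>

locale heisenberg_product =
  fixes pr :: "'r::ab_group_add \<Rightarrow> 'r \<Rightarrow> 'r" and e :: 'r
  assumes pr_add_left: "pr (x + y) z = pr x z + pr y z"
    and pr_add_right: "pr x (y + z) = pr x y + pr x z"
    and pr_unit_left: "pr e x = x"
    and pr_unit_right: "pr x e = x"
begin

fun heis_mult :: "('r \<times> 'r) \<times> 'r \<Rightarrow> ('r \<times> 'r) \<times> 'r \<Rightarrow> ('r \<times> 'r) \<times> 'r" where
  "heis_mult ((a, b), c) ((a', b'), c') = ((a + a', b + b'), c + c' + pr b a')"

lemma pr_zero [simp]: "pr 0 x = 0" "pr x 0 = 0"
  using pr_add_left[of 0 0 x] pr_add_right[of x 0 0] by simp_all

lemma heis_mult_assoc: "heis_mult (heis_mult g h) k = heis_mult g (heis_mult h k)"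
  by (cases "(g, h, k)" rule: prod_cases3; cases g; cases h; cases k)
    (auto simp: pr_add_left pr_add_right algebra_simps)

lemma fst_heis_mult: "fst (heis_mult g h) = fst g + fst h"
  by (cases "(g, h)" rule: heis_mult.cases) simp

abbreviation central :: "'r \<Rightarrow> ('r \<times> 'r) \<times> 'r" where "central c \<equiv> ((0, 0), c)"

lemma heis_mult_central: "heis_mult (v, c) (central c') = (v, c + c')" "heis_mult (central c') (v, c) = (v, c' + c)"
  by (cases v; simp)+

lemma central_commutes: "heis_mult (central c) g = heis_mult g (central c)"
  by (cases g) (simp add: heis_mult_central add.commute)

lemma central_add: "heis_mult (central c) (central c') = central (c + c')"
  by simp

context
  fixes \<alpha>
  assumes \<alpha>: "cocycle heis_mult \<alpha>"
begin

abbreviation \<chi> where "\<chi> \<equiv> comm_pairing \<alpha>"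

lemma chi_nonzero: "\<chi> x y \<noteq> 0"
  using cocycle_nonzero[OF \<alpha>] by (simp add: comm_pairing_def)

lemma chi_central_right: "\<chi> (central c) (heis_mult g h) = \<chi> (central c) g * \<chi> (central c) h"
  by (rule comm_pairing_mult_right[OF \<alpha>]) (rule central_commutes)+

lemma chi_central_left: "\<chi> (central (c + c')) g = \<chi> (central c) g * \<chi> (central c') g"
  using comm_pairing_mult_left[OF \<alpha>, of g "central c" "central c'", OF central_commutes[symmetric] central_commutes[symmetric]]
  unfolding central_add .

text \<open>
  Since \<open>pr d e = d\<close>, the central element of $d$ is a commutator in the group, and multiplicative maps
  into the complex numbers kill commutators.
\<close>

lemma chi_central_central: "\<chi> (central c) (central d) = 1"
proof -
  have "\<chi> (central c) (heis_mult ((0, d), 0) ((e, 0), 0)) = \<chi> (central c) (heis_mult ((e, 0), 0) ((0, d), 0))"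
    by (simp only: chi_central_right mult.commute)
  moreover have "\<chi> (central c) (heis_mult ((e, 0), 0) ((0, d), 0)) \<noteq> 0"
    by (rule chi_nonzero)
  moreover have "heis_mult ((0, d), 0) ((e, 0), 0) = heis_mult (heis_mult ((e, 0), 0) ((0, d), 0)) (central d)"
    by (simp add: pr_unit_right)
  ultimately show ?thesis
    by (simp add: chi_central_right del: heis_mult.simps)
qed

lemma chi_central_split: "\<chi> (central c) ((a, b), d) = \<chi> (central c) ((a, 0), 0) * \<chi> (central c) ((0, b), 0)"
proof -
  have "((a, b), d) = heis_mult (heis_mult ((a, 0), 0) ((0, b), 0)) (central d)" by simp
  then show ?thesis by (simp only: chi_central_right chi_central_central mult_1_right)
qed

text \<open>
  Conjugation by $(0, c, 0)$ sends the commuting elements $(a, 0, 0)$ and $(e, 0, 0)$ to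
  $(a, 0, c a)$ and $(e, 0, c)$. Invariance of their commutator says that the contributions of
  the central parts cancel, which is an instance of the Jacobi identity.
\<close>

lemma chi_jacobi_a: "\<chi> (central c) ((a, 0), 0) = \<chi> (central (pr c a)) ((e, 0), 0)"
proof -
  let ?x = "((a, 0), 0)" and ?y = "((e, 0), 0)"
  have "\<chi> ?x ?y = \<chi> (heis_mult ?x (central (pr c a))) (heis_mult ?y (central c))"
    by (rule comm_pairing_conj[OF \<alpha>, symmetric, of _ _ _ _ "((0, c), 0)"])
      (simp_all add: add_ac pr_unit_right)
  also have "\<dots> = \<chi> (heis_mult ?x (central (pr c a))) ?y * \<chi> (heis_mult ?x (central (pr c a))) (central c)"
    by (rule comm_pairing_mult_right[OF \<alpha>]) (simp_all add: add_ac)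
  also have "\<chi> (heis_mult ?x (central (pr c a))) ?y = \<chi> ?x ?y * \<chi> (central (pr c a)) ?y"
    by (rule comm_pairing_mult_left[OF \<alpha>]) (simp_all add: add_ac)
  also have "\<chi> (heis_mult ?x (central (pr c a))) (central c) = inverse (\<chi> (central c) (heis_mult ?x (central (pr c a))))"
    by (rule comm_pairing_swap)
  also have "\<chi> (central c) (heis_mult ?x (central (pr c a))) = \<chi> (central c) ?x"
    by (simp only: chi_central_right chi_central_central mult_1_right)
  finally show ?thesis
    using chi_nonzero by (simp add: field_simps)
qed

text \<open>
  As before, with $(c, 0, 0)$ conjugating $(0, b, b c)$ and $(0, e, c)$ to $(0, b, 0)$ and $(0, e, 0)$.
\<close>

lemma chi_jacobi_b: "\<chi> (central c) ((0, b), 0) = \<chi> (central (pr b c)) ((0, e), 0)"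
proof -
  let ?x = "((0, b), 0)" and ?y = "((0, e), 0)"
  have "\<chi> ?x ?y = \<chi> (heis_mult ?x (central (pr b c))) (heis_mult ?y (central c))"
    by (rule comm_pairing_conj[OF \<alpha>, of _ _ _ _ "((c, 0), 0)"])
      (simp_all add: add_ac pr_unit_left)
  also have "\<dots> = \<chi> (heis_mult ?x (central (pr b c))) ?y * \<chi> (heis_mult ?x (central (pr b c))) (central c)"
    by (rule comm_pairing_mult_right[OF \<alpha>]) (simp_all add: add_ac)
  also have "\<chi> (heis_mult ?x (central (pr b c))) ?y = \<chi> ?x ?y * \<chi> (central (pr b c)) ?y"
    by (rule comm_pairing_mult_left[OF \<alpha>]) (simp_all add: add_ac)
  also have "\<chi> (heis_mult ?x (central (pr b c))) (central c) = inverse (\<chi> (central c) (heis_mult ?x (central (pr b c))))"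
    by (rule comm_pairing_swap)
  also have "\<chi> (central c) (heis_mult ?x (central (pr b c))) = \<chi> (central c) ?x"
    by (simp only: chi_central_right chi_central_central mult_1_right)
  finally show ?thesis
    using chi_nonzero by (simp add: field_simps)
qed

text \<open>
  The characters are the commutators with the lifts of $(e, 0, 0)$ and $(0, e, 0)$.
\<close>

lemma central_commutators:
  obtains \<phi> \<psi> where "character \<phi>" "character \<psi>"
    "\<And>a b c d. \<chi> (central c) ((a, b), d) = \<phi> (pr c a) * \<psi> (pr b c)"
proof
  show "character (\<lambda>c. \<chi> (central c) ((e, 0), 0))" "character (\<lambda>c. \<chi> (central c) ((0, e), 0))"
    by (simp_all add: character_def chi_nonzero chi_central_left)
  show "\<chi> (central c) ((a, b), d) = \<chi> (central (pr c a)) ((e, 0), 0) * \<chi> (central (pr b c)) ((0, e), 0)"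
    for a b c d
    unfolding chi_central_split[of c a b d] by (simp only: chi_jacobi_a[of c a] chi_jacobi_b[of c b])
qed

text \<open>
  If the lifts of the centre are central in the extension and $u$ is a homomorphic lift of the
  centre, then its image is a normal subgroup of the extension, and dividing by it gives an extension of the
  abelian quotient of the Heisenberg group. On factor sets: lift $(v, c)$ by the product of the lift
  of $(v, 0)$ and that of $c$.
\<close>

lemma cohom_inflation:
  assumes symm: "\<And>c g. \<alpha> (central c) g = \<alpha> g (central c)"
    and u: "\<And>c. u c \<noteq> 0" "\<And>c c'. \<alpha> (central c) (central c') * (u c * u c') = u (c + c')"
  obtains \<tau> where "cocycle (+) \<tau>" "cohom heis_mult \<alpha> (\<lambda>g h. \<tau> (fst g) (fst h))"
proof -
  note nz = cocycle_nonzero[OF \<alpha>]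
  \<comment> \<open>The lift of the identity is the unit of the extension only up to the constant \<open>\<alpha> (central 0) (central 0)\<close>.\<close>
  define w where "w g = u (snd g) * \<alpha> (fst g, 0) (central (snd g)) / \<alpha> (central 0) (central 0)" for g
  define \<beta> where "\<beta> = (\<lambda>g h. \<alpha> g h * (w g * w h) / w (heis_mult g h))"
  have w: "w g \<noteq> 0" for g using u(1) nz by (simp add: w_def)
  have \<beta>: "cocycle heis_mult \<beta>"
    unfolding \<beta>_def by (rule cocycle_cohom[of heis_mult \<alpha> w, OF \<alpha> heis_mult_assoc w])
  have zero: "\<alpha> (central 0) (central c) = \<alpha> (central 0) (central 0)" for c
    using cocycle_eq[OF \<alpha>, of "central 0" "central 0" "central c"] nz by simp
  have right: "\<beta> g (central c') = 1" for g c'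
  proof -
    obtain v c where g: "g = (v, c)" by (cases g)
    have "\<alpha> (v, 0) (central c) * \<alpha> (v, c) (central c') = \<alpha> (v, 0) (central (c + c')) * \<alpha> (central c) (central c')"
      using cocycle_eq[OF \<alpha>, of "(v, 0)" "central c" "central c'"] by (simp add: heis_mult_central del: heis_mult.simps)
    then have "\<alpha> (v, c) (central c') = \<alpha> (v, 0) (central (c + c')) * \<alpha> (central c) (central c') / \<alpha> (v, 0) (central c)"
      using nz by (simp add: field_simps)
    moreover have "w (v, c + c') = \<alpha> (central c) (central c') * (u c * u c') * \<alpha> (v, 0) (central (c + c')) / \<alpha> (central 0) (central 0)"
      unfolding w_def u(2) by simp
    moreover have "w (central c') = u c'"
      using nz zero[of c'] by (simp add: w_def)
    moreover have "w (v, c) = u c * \<alpha> (v, 0) (central c) / \<alpha> (central 0) (central 0)"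
      by (simp add: w_def)
    ultimately show ?thesis
      unfolding \<beta>_def g heis_mult_central using u(1) nz by simp
  qed
  have left: "\<beta> (central c) g = 1" for g c
    using right[of g c] unfolding \<beta>_def symm[of c g] central_commutes[of c g]
    by (simp only: mult.commute)
  have 1: "\<beta> g (heis_mult h (central c)) = \<beta> g h" for g h c
    using cocycle_eq[OF \<beta>, of g h "central c"] by (simp add: right)
  have 2: "\<beta> (heis_mult g (central c)) h = \<beta> g h" for g h c
    using cocycle_eq[OF \<beta>, of g "central c" h]
    by (simp only: central_commutes[of c h] 1 right left mult_1_left mult_1_right)
  define \<tau> where "\<tau> v v' = \<beta> (v, 0) (v', 0)" for v v'
  have \<tau>: "\<beta> g h = \<tau> (fst g) (fst h)" for g h
    using 1[of "(fst g, 0)" "(fst h, 0)" "snd h"] 2[of "(fst g, 0)" "snd g" h]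
    by (simp add: heis_mult_central \<tau>_def del: heis_mult.simps)
  have "cocycle (+) \<tau>"
    unfolding cocycle_def
  proof (intro conjI allI)
    show "\<tau> x y \<noteq> 0" for x y using cocycle_nonzero[OF \<beta>] by (simp add: \<tau>_def)
    show "\<tau> x y * \<tau> (x + y) z = \<tau> x (y + z) * \<tau> y z" for x y z
      using cocycle_eq[OF \<beta>, of "(x, 0)" "(y, 0)" "(z, 0)"]
      by (simp add: \<tau> fst_heis_mult del: heis_mult.simps)
  qed
  moreover have "cohom heis_mult \<alpha> (\<lambda>g h. \<tau> (fst g) (fst h))"
    unfolding cohom_def by (intro exI[of _ w]) (simp add: w flip: \<tau>, simp add: \<beta>_def w)
  ultimately show ?thesis using that by blast
qed

end
end

section \<open>Cocycles of elementary abelian groups\<close>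

lemma complex_root_exists:
  assumes "n > 0"
  obtains z :: complex where "z ^ n = w"
proof
  show "rcis (root n (cmod w)) (Arg w / n) ^ n = w"
    using assms by (simp add: DeMoivre2 rcis_cmod_Arg)
qed

abbreviation rep :: "'p::prime_card mod_ring \<Rightarrow> nat" where
  "rep x \<equiv> nat (to_int_mod_ring x)"

lemma of_nat_rep: "of_nat (rep x) = (x :: 'p::prime_card mod_ring)"
proof -
  have "to_int_mod_ring x \<ge> 0"
    using range_to_int_mod_ring[where 'a='p] by (metis atLeastLessThan_iff rangeI)
  then have "of_nat (rep x) = (of_int (to_int_mod_ring x) :: 'p mod_ring)"
    by (metis of_int_of_nat_eq nat_0_le)
  then show ?thesis by (simp add: of_int_of_int_mod_ring)
qed

lemma of_nat_eq_mod_ring: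
  "of_nat m = (of_nat n :: 'p::prime_card mod_ring) \<Longrightarrow> m mod CARD('p) = n mod CARD('p)"
  by (simp add: of_nat_eq_iff_cong_CHAR cong_def)

lemma card_pos: "CARD('p::prime_card) > 0"
  by (rule prime_gt_0_nat) (rule prime_card)

lemma root_power_cong:
  fixes z :: complex
  assumes "z ^ n = 1" "i mod n = j mod n"
  shows "z ^ i = z ^ j"
proof -
  have "z ^ i = z ^ (i mod n)" for i
  proof -
    have "z ^ i = z ^ (n * (i div n) + i mod n)" by simp
    also have "\<dots> = z ^ (i mod n)" by (simp only: power_add power_mult assms(1) power_one mult_1_left)
    finally show ?thesis .
  qed
  then show ?thesis using assms(2) by metis
qed

lemma fpow_of_nat:
  assumes "\<mu> ^ CARD('p::prime_card) = 1"
  shows "\<mu> ^\<^sub>p (of_nat n :: 'p mod_ring) = \<mu> ^ n"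
  unfolding fpow_def by (rule root_power_cong[OF assms]) (rule of_nat_eq_mod_ring[where 'p='p], rule of_nat_rep)

lemma character_fpow:
  assumes "\<mu> ^ CARD('p::prime_card) = 1"
  shows "character (\<lambda>x :: 'p mod_ring. \<mu> ^\<^sub>p x)"
  unfolding character_def
proof (intro conjI allI)
  have "\<mu> \<noteq> 0" using assms card_pos[where 'p='p] by (auto simp: power_0_left)
  then show "\<mu> ^\<^sub>p x \<noteq> 0" for x :: "'p mod_ring" by (simp add: fpow_def)
  fix x y :: "'p mod_ring"
  have "\<mu> ^\<^sub>p (x + y) = \<mu> ^\<^sub>p (of_nat (rep x + rep y) :: 'p mod_ring)"
    by (simp only: of_nat_rep of_nat_add)
  then show "\<mu> ^\<^sub>p (x + y) = \<mu> ^\<^sub>p x * \<mu> ^\<^sub>p y"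
    unfolding fpow_of_nat[OF assms] by (simp add: power_add fpow_def)
qed

lemma character_of_nat:
  assumes "character \<phi>"
  shows "\<phi> (of_nat n) = \<phi> 1 ^ n"
  by (induction n) (simp_all add: character_zero[OF assms] character_add[OF assms])

lemma character_mod_ring:
  fixes \<phi> :: "'p::prime_card mod_ring \<Rightarrow> complex"
  assumes "character \<phi>"
  shows "\<phi> 1 ^ CARD('p) = 1" "\<phi> x = \<phi> 1 ^\<^sub>p x"
proof -
  show "\<phi> 1 ^ CARD('p) = 1"
    using character_of_nat[OF assms, of "CARD('p)"] by (simp add: character_zero[OF assms])
  have "\<phi> x = \<phi> (of_nat (rep x))" by (simp only: of_nat_rep)
  then show "\<phi> x = \<phi> 1 ^\<^sub>p x"
    unfolding character_of_nat[OF assms] fpow_def .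
qed

lemma fpow_root: "\<mu> ^ n = 1 \<Longrightarrow> (\<mu> ^\<^sub>p x) ^ n = 1"
  unfolding fpow_def by (metis power_mult mult.commute power_one)

lemma fpow_mult:
  assumes "\<mu> ^ CARD('p::prime_card) = 1"
  shows "\<mu> ^\<^sub>p (x * y :: 'p mod_ring) = (\<mu> ^\<^sub>p x) ^\<^sub>p y"
proof -
  note \<mu> = character_fpow[OF assms]
  have "character (\<lambda>y. \<mu> ^\<^sub>p (x * y))"
    using character_nonzero[OF \<mu>] character_add[OF \<mu>] by (simp add: character_def distrib_left)
  from character_mod_ring(2)[OF this] show ?thesis by simp
qed

text \<open>
  Let $X$ be a lift of $1$ in the extension. Its powers $X^n$ are $g(n)$ times the lift of $n$, and
  $X^p$ is a scalar; dividing $X$ by a $p$-th root $z$ of this scalar gives a lift of order $p$, whose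
  powers form a homomorphic section.
\<close>

lemma cocycle_mod_ring_trivial:
  fixes \<alpha> :: "'p::prime_card mod_ring \<Rightarrow> 'p mod_ring \<Rightarrow> complex"
  assumes \<alpha>: "cocycle (+) \<alpha>"
  shows "cohom (+) \<alpha> (\<lambda>_ _. 1)"
proof -
  note nz = cocycle_nonzero[OF \<alpha>]
  let ?p = "CARD('p)"
  have zero: "\<alpha> 0 x = \<alpha> 0 0" "\<alpha> x 0 = \<alpha> 0 0" for x
    using cocycle_eq[OF \<alpha>, of 0 0 x] cocycle_eq[OF \<alpha>, of x 0 0] nz by simp_all
  \<comment> \<open>The division makes \<open>g 0\<close> times the lift of 0 the unit of the extension.\<close>
  define g where "g n = (\<Prod>i<n. \<alpha> 1 (of_nat i)) / \<alpha> 0 0" for n :: nat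
  have g_nz: "g n \<noteq> 0" for n using nz by (simp add: g_def)
  have g_Suc: "g (Suc n) = g n * \<alpha> 1 (of_nat n)" for n by (simp add: g_def)
  have g_add: "g (m + n) = g m * g n * \<alpha> (of_nat m) (of_nat n)" for m n
  proof (induction m)
    case 0
    show ?case using nz zero(1)[of "of_nat n"] by (simp add: g_def)
  next
    case (Suc m)
    have "g (Suc m + n) = g m * g n * (\<alpha> 1 (of_nat m + of_nat n) * \<alpha> (of_nat m) (of_nat n))"
      using Suc by (simp add: g_Suc)
    also have "\<dots> = g m * g n * (\<alpha> 1 (of_nat m) * \<alpha> (1 + of_nat m) (of_nat n))"
      by (simp only: cocycle_eq[OF \<alpha>])
    finally show ?case by (simp add: g_Suc mult_ac)
  qed
  obtain z where z: "z ^ ?p = g ?p * \<alpha> 0 0"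
    using complex_root_exists[OF card_pos[where 'p='p]] by blast
  have z_nz: "z \<noteq> 0" using z g_nz nz card_pos[where 'p='p] by (auto simp: power_0_left)
  define v where "v n = g n / z ^ n" for n
  have v_p: "v (n + ?p) = v n" for n
    using z_nz g_nz nz zero(2)[of "of_nat n"] by (simp add: v_def g_add power_add z)
  have "v (n + m * ?p) = v n" for n m
    by (induction m) (simp_all add: v_p flip: add.assoc add: add.commute[of ?p])
  then have v_mod: "v n = v (n mod ?p)" for n
    using mod_mult_div_eq[of n ?p] by (metis mult.commute)
  have "v (rep (x + y)) = v (rep x + rep y)" for x y :: "'p mod_ring"
  proof -
    have "rep (x + y) mod ?p = (rep x + rep y) mod ?p"
      by (rule of_nat_eq_mod_ring[where 'p='p]) (simp only: of_nat_rep of_nat_add)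
    then show ?thesis using v_mod by metis
  qed
  also have "v (rep x + rep y) = v (rep x) * v (rep y) * \<alpha> x y" for x y :: "'p mod_ring"
    by (simp only: v_def g_add of_nat_rep) (simp add: power_add)
  finally show ?thesis
    unfolding cohom_def using g_nz z_nz
    by (intro exI[of _ "\<lambda>x. v (rep x)"]) (simp add: v_def)
qed

lemma bicharacter_mod_ring:
  fixes B :: "'p::prime_card mod_ring \<Rightarrow> 'p mod_ring \<Rightarrow> complex"
  assumes "\<And>x. character (B x)" "\<And>y. character (\<lambda>x. B x y)"
  shows "B 1 1 ^ CARD('p) = 1" "B x y = B 1 1 ^\<^sub>p (x * y)"
proof -
  show 1: "B 1 1 ^ CARD('p) = 1" using character_mod_ring(1)[OF assms(1)] .
  have "B x y = B x 1 ^\<^sub>p y" using character_mod_ring(2)[OF assms(1)] .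
  also have "B x 1 = B 1 1 ^\<^sub>p x" using character_mod_ring(2)[OF assms(2)] .
  finally show "B x y = B 1 1 ^\<^sub>p (x * y)" by (simp only: fpow_mult[OF 1])
qed

text \<open>
  Both factors of the Kuenneth decomposition are trivial, so only the pairing between them survives.
\<close>

lemma cocycle_mod_ring_square:
  fixes \<alpha> :: "'p::prime_card mod_ring \<times> 'p mod_ring \<Rightarrow> 'p mod_ring \<times> 'p mod_ring \<Rightarrow> complex"
  assumes \<alpha>: "cocycle (+) \<alpha>"
  defines "\<mu> \<equiv> comm_pairing \<alpha> (0, 1) (1, 0)"
  shows "\<mu> ^ CARD('p) = 1" "cohom (+) \<alpha> (\<lambda>x y. \<mu> ^\<^sub>p (snd x * fst y))"
proof -
  let ?B = "\<lambda>x y. comm_pairing \<alpha> (0, x) (y, 0)"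
  note B = bicharacter_mod_ring[of ?B, OF character_pairing_right[OF \<alpha>] character_pairing_left[OF \<alpha>]]
  show "\<mu> ^ CARD('p) = 1" using B(1) by (simp only: \<mu>_def)
  have "cocycle (+) (\<lambda>x y. \<alpha> (x, 0) (y, 0))" "cocycle (+) (\<lambda>x y. \<alpha> (0, x) (0, y))"
    by (rule cocycle_pullback[OF \<alpha>], simp)+
  note this[THEN cocycle_mod_ring_trivial]
  then have "cohom (+) (\<lambda>x y. \<alpha> (fst x, 0) (fst y, 0)) (\<lambda>_ _. 1)"
    and "cohom (+) (\<lambda>x y. \<alpha> (0, snd x) (0, snd y)) (\<lambda>_ _. 1)"
    using cohom_pullback[where f = fst and n = "(+)"] cohom_pullback[where f = snd and n = "(+)"]
    by fastforce+
  from cohom_trans[OF cocycle_kuenneth[OF \<alpha>] cohom_mult[OF cohom_mult[OF this] cohom_refl]]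
  show "cohom (+) \<alpha> (\<lambda>x y. \<mu> ^\<^sub>p (snd x * fst y))"
    unfolding B(2)[folded \<mu>_def] by simp
qed

lemma symmetric_cocycle_mod_ring_square_trivial:
  fixes \<alpha> :: "'p::prime_card mod_ring \<times> 'p mod_ring \<Rightarrow> 'p mod_ring \<times> 'p mod_ring \<Rightarrow> complex"
  assumes \<alpha>: "cocycle (+) \<alpha>" and "\<And>x y. \<alpha> x y = \<alpha> y x"
  shows "cohom (+) \<alpha> (\<lambda>_ _. 1)"
proof -
  have "comm_pairing \<alpha> (0, 1) (1, 0) = 1"
    using assms(2)[of "(0, 1)" "(1, 0)"] cocycle_nonzero[OF \<alpha>] by (simp add: comm_pairing_def)
  then show ?thesis
    using cocycle_mod_ring_square(2)[OF \<alpha>] by (simp add: fpow_def)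
qed

lemma character_mod_ring_square:
  fixes \<phi> :: "'p::prime_card mod_ring \<times> 'p mod_ring \<Rightarrow> complex"
  assumes \<phi>: "character \<phi>"
  shows "\<phi> (1, 0) ^ CARD('p) = 1" "\<phi> (0, 1) ^ CARD('p) = 1"
    "\<phi> (x, y) = \<phi> (1, 0) ^\<^sub>p x * \<phi> (0, 1) ^\<^sub>p y"
proof -
  have l: "character (\<lambda>x. \<phi> (x, 0))" and r: "character (\<lambda>y. \<phi> (0, y))"
    using character_nonzero[OF \<phi>] character_add[OF \<phi>, of "(_, 0)" "(_, 0)"]
      character_add[OF \<phi>, of "(0, _)" "(0, _)"]
    by (simp_all add: character_def)
  show "\<phi> (1, 0) ^ CARD('p) = 1" "\<phi> (0, 1) ^ CARD('p) = 1"
    using character_mod_ring(1)[OF l] character_mod_ring(1)[OF r] .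
  have "\<phi> (x, y) = \<phi> (x, 0) * \<phi> (0, y)"
    using character_add[OF \<phi>, of "(x, 0)" "(0, y)"] by simp
  then show "\<phi> (x, y) = \<phi> (1, 0) ^\<^sub>p x * \<phi> (0, 1) ^\<^sub>p y"
    by (simp only: character_mod_ring(2)[OF l, of x] character_mod_ring(2)[OF r, of y])
qed

text \<open>
  The Kuenneth decomposition into the $a$-plane and the $b$-plane. Each plane contributes one
  root of unity, the pairing of the planes contributes the matrix \<open>\<omega>\<close>.
\<close>

lemma cocycle_mod_ring_fourth:
  fixes \<alpha> :: "('p::prime_card mod_ring \<times> 'p mod_ring) \<times> ('p mod_ring \<times> 'p mod_ring) \<Rightarrow> _ \<Rightarrow> complex"
  assumes \<alpha>: "cocycle (+) \<alpha>"
  obtains \<mu> \<nu> :: complex and \<omega> :: "nat \<Rightarrow> nat \<Rightarrow> complex"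
  where "\<mu> ^ CARD('p) = 1" "\<nu> ^ CARD('p) = 1" "\<And>i j. \<omega> i j ^ CARD('p) = 1"
    "cohom (+) \<alpha> (\<lambda>((a1, a2), (b1, b2)) ((a1', a2'), (b1', b2')).
       \<mu> ^\<^sub>p (a2 * a1') * \<nu> ^\<^sub>p (b2 * b1') *
       (\<omega> 1 1 ^\<^sub>p (b1 * a1') * \<omega> 1 2 ^\<^sub>p (b1 * a2') * \<omega> 2 1 ^\<^sub>p (b2 * a1') * \<omega> 2 2 ^\<^sub>p (b2 * a2')))"
proof -
  define \<omega> where "\<omega> i j = comm_pairing \<alpha> (0, if i = 1 then (1, 0) else (0, 1))
    (if j = 1 then (1, 0) else (0, 1), 0)" for i j :: nat
  have L: "character (\<lambda>b. comm_pairing \<alpha> (0, b) x)" for x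
    by (rule character_pairing_left[OF \<alpha>])
  have R: "character (\<lambda>a. comm_pairing \<alpha> x (a, 0))" for x
    by (rule character_pairing_right[OF \<alpha>])
  have \<omega>_root: "\<omega> i j ^ CARD('p) = 1" for i j
    using character_mod_ring_square(1,2)[OF L, of "(if j = 1 then (1, 0) else (0, 1), 0)"]
    by (cases "i = 1"; cases "j = 1"; simp add: \<omega>_def)
  have pairing: "comm_pairing \<alpha> (0, (b1, b2)) ((a1, a2), 0) =
      \<omega> 1 1 ^\<^sub>p (b1 * a1) * \<omega> 1 2 ^\<^sub>p (b1 * a2) * \<omega> 2 1 ^\<^sub>p (b2 * a1) * \<omega> 2 2 ^\<^sub>p (b2 * a2)"
    for b1 b2 a1 a2
  proof -
    have fp: "(x * y) ^\<^sub>p c = (x ^\<^sub>p c) * (y ^\<^sub>p c)" for x y and c :: "'p mod_ring"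
      by (simp add: fpow_def power_mult_distrib)
    have fm: "(\<omega> i j ^\<^sub>p a) ^\<^sub>p b = \<omega> i j ^\<^sub>p (b * a)" for i j and a b :: "'p mod_ring"
      using fpow_mult[OF \<omega>_root, of i j a b] by (simp only: mult.commute)
    have "comm_pairing \<alpha> (0, (b1, b2)) ((a1, a2), 0) =
       comm_pairing \<alpha> (0, (1, 0)) ((a1, a2), 0) ^\<^sub>p b1 * comm_pairing \<alpha> (0, (0, 1)) ((a1, a2), 0) ^\<^sub>p b2"
      by (rule character_mod_ring_square(3)[OF L])
    also have "comm_pairing \<alpha> (0, (1, 0)) ((a1, a2), 0) = \<omega> 1 1 ^\<^sub>p a1 * \<omega> 1 2 ^\<^sub>p a2"
      by (simp add: \<omega>_def character_mod_ring_square(3)[OF R, of "(0, 1, 0)" a1 a2])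
    also have "comm_pairing \<alpha> (0, (0, 1)) ((a1, a2), 0) = \<omega> 2 1 ^\<^sub>p a1 * \<omega> 2 2 ^\<^sub>p a2"
      by (simp add: \<omega>_def character_mod_ring_square(3)[OF R, of "(0, 0, 1)" a1 a2])
    finally show ?thesis
      by (simp only: fp fm mult.assoc)
  qed
  let ?A = "\<lambda>x y. \<alpha> (x, 0) (y, 0)" and ?B = "\<lambda>x y. \<alpha> (0, x) (0, y)"
  have A: "cocycle (+) ?A" and B: "cocycle (+) ?B"
    by (rule cocycle_pullback[OF \<alpha>], simp)+
  define \<mu> \<nu> where "\<mu> = comm_pairing ?A (0, 1) (1, 0)" and "\<nu> = comm_pairing ?B (0, 1) (1, 0)"
  note \<mu> = cocycle_mod_ring_square[OF A, folded \<mu>_def]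
  note \<nu> = cocycle_mod_ring_square[OF B, folded \<nu>_def]
  have 1: "cohom (+) (\<lambda>x y. \<alpha> (fst x, 0) (fst y, 0)) (\<lambda>x y. \<mu> ^\<^sub>p (snd (fst x) * fst (fst y)))"
    using cohom_pullback[OF \<mu>(2), of fst "(+)"] by simp
  have 2: "cohom (+) (\<lambda>x y. \<alpha> (0, snd x) (0, snd y)) (\<lambda>x y. \<nu> ^\<^sub>p (snd (snd x) * fst (snd y)))"
    using cohom_pullback[OF \<nu>(2), of snd "(+)"] by simp
  have "cohom (+) \<alpha> (\<lambda>x y. \<mu> ^\<^sub>p (snd (fst x) * fst (fst y)) * \<nu> ^\<^sub>p (snd (snd x) * fst (snd y))
       * comm_pairing \<alpha> (0, snd x) (fst y, 0))"
    by (rule cohom_trans[OF cocycle_kuenneth[OF \<alpha>] cohom_mult[OF cohom_mult[OF 1 2] cohom_refl]])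
  also have "(\<lambda>x y. \<mu> ^\<^sub>p (snd (fst x) * fst (fst y)) * \<nu> ^\<^sub>p (snd (snd x) * fst (snd y))
       * comm_pairing \<alpha> (0, snd x) (fst y, 0)) =
    (\<lambda>((a1, a2), (b1, b2)) ((a1', a2'), (b1', b2')).
       \<mu> ^\<^sub>p (a2 * a1') * \<nu> ^\<^sub>p (b2 * b1') *
       (\<omega> 1 1 ^\<^sub>p (b1 * a1') * \<omega> 1 2 ^\<^sub>p (b1 * a2') * \<omega> 2 1 ^\<^sub>p (b2 * a1') * \<omega> 2 2 ^\<^sub>p (b2 * a2')))"
    by (auto simp: fun_eq_iff pairing)
  finally show ?thesis using that \<mu>(1) \<nu>(1) \<omega>_root by blast
qed

section \<open>The Heisenberg group in coordinates\<close>

text \<open>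
  Multiplication of $x_1 + x_2 t$ and $y_1 + y_2 t$ modulo $t^2 - k$.
\<close>

fun qmul :: "'p::prime_card mod_ring \<Rightarrow> 'p mod_ring \<times> 'p mod_ring \<Rightarrow> 'p mod_ring \<times> 'p mod_ring
    \<Rightarrow> 'p mod_ring \<times> 'p mod_ring" where
  "qmul k (x1, x2) (y1, y2) = (x1 * y1 + k * x2 * y2, x1 * y2 + x2 * y1)"

interpretation H: heisenberg_product "qmul k" "(1, 0)" for k :: "'p::prime_card mod_ring"
proof
  fix x y z :: "'p mod_ring \<times> 'p mod_ring"
  show "qmul k (x + y) z = qmul k x z + qmul k y z"
    by (cases x; cases y; cases z) (simp add: algebra_simps)
  show "qmul k x (y + z) = qmul k x y + qmul k x z"
    by (cases x; cases y; cases z) (simp add: algebra_simps)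
  show "qmul k (1, 0) x = x" "qmul k x (1, 0) = x"
    by (cases x; simp)+
qed

abbreviation hmul where "hmul \<equiv> H.heis_mult"

text \<open>
  The triple is $((a, b), c)$ with $a$, $b$, $c$ in the quadratic ring, so the first component is
  the image in the abelian quotient by the centre.
\<close>

type_synonym 'p coords =
  "(('p mod_ring \<times> 'p mod_ring) \<times> ('p mod_ring \<times> 'p mod_ring)) \<times> ('p mod_ring \<times> 'p mod_ring)"

text \<open>
  The pair of exponents $q_5, q_6$. Up to bilinear terms these are the coordinates of
  $c a' + b a'^2 / 2$, which pairs a central $c$ on the left with $a'$ on the right.
\<close>

fun exp_za :: "'p::prime_card mod_ring \<Rightarrow> 'p coords \<Rightarrow> 'p coords \<Rightarrow> 'p mod_ring \<times> 'p mod_ring" where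
  "exp_za k (((a1, a2), (b1, b2)), (c1, c2)) (((a1', a2'), (b1', b2')), (c1', c2')) =
     (b1 * binom2 a1' + k * b1 * binom2 a2' + k * b2 * a1' * a2' + a1' * c1 + k * a2' * c2,
      b2 * binom2 a1' + k * b2 * binom2 a2' + b1 * a1' * a2' + a1' * c2 + a2' * c1)"

text \<open>
  The pair of exponents $q_7, q_8$. Up to bilinear terms these are the coordinates of
  $- b c' - b^2 a' / 2$, which pairs $b$ on the left with a central $c'$ on the right.
\<close>

fun exp_bz :: "'p::prime_card mod_ring \<Rightarrow> 'p coords \<Rightarrow> 'p coords \<Rightarrow> 'p mod_ring \<times> 'p mod_ring" where
  "exp_bz k (((a1, a2), (b1, b2)), (c1, c2)) (((a1', a2'), (b1', b2')), (c1', c2')) =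
     (a1' * binom2 b1 + k * a1' * binom2 b2 - b1 ^ 2 * a1' - b1 * c1' - k * b2 * c2'
        - k * b2 ^ 2 * a1' - k * b1 * b2 * a2',
      a2' * binom2 b1 + k * a2' * binom2 b2 - k * b2 ^ 2 * a2' - b2 * c1' - b1 * c2'
        - b1 ^ 2 * a2' - b1 * b2 * a1')"

text \<open>
  The first four entries are the exponents of $\<mu>_1, \<dots>, \<mu>_4$; the last two are the bilinear
  exponents that \<open>cohom_central_coordinates\<close> eliminates.
\<close>

fun exp_bilin :: "nat \<Rightarrow> 'p::prime_card coords \<Rightarrow> 'p coords \<Rightarrow> 'p mod_ring" where
  "exp_bilin i (((a1, a2), (b1, b2)), c) (((a1', a2'), (b1', b2')), c') =
     [a2 * a1', b2 * a1', b2 * a2', b2 * b1', b1 * a1', b1 * a2'] ! i"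

lemma two_nonzero:
  assumes "odd CARD('p::prime_card)"
  shows "(2 :: 'p mod_ring) \<noteq> 0"
proof
  assume "(2 :: 'p mod_ring) = 0"
  then have "of_nat 2 = (0 :: 'p mod_ring)" by simp
  then have "CARD('p) dvd 2" by (rule of_nat_0_mod_ring_dvd)
  moreover have "prime (CARD('p))" by (rule prime_card)
  ultimately show False
    using assms by (metis primes_dvd_imp_eq two_is_prime_nat even_numeral dvd_refl)
qed

text \<open>
  Division by 2 enters the cocycle identities only through this rule.
\<close>

lemma binom2_add:
  assumes "odd CARD('p::prime_card)"
  shows "binom2 (x + y :: 'p mod_ring) = binom2 x + binom2 y + x * y"
  unfolding binom2_def using two_nonzero[OF assms] by (simp add: field_simps)

lemma exp_cocycle:
  fixes k :: "'p::prime_card mod_ring" and g h l :: "'p coords"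
  assumes "odd CARD('p)"
  shows "exp_za k g h + exp_za k (hmul k g h) l = exp_za k g (hmul k h l) + exp_za k h l"
    "exp_bz k g h + exp_bz k (hmul k g h) l = exp_bz k g (hmul k h l) + exp_bz k h l"
proof -
  obtain a1 a2 b1 b2 c1 c2 where g: "g = (((a1, a2), (b1, b2)), (c1, c2))" by (metis surj_pair)
  obtain a1' a2' b1' b2' c1' c2' where h: "h = (((a1', a2'), (b1', b2')), (c1', c2'))" by (metis surj_pair)
  obtain a1'' a2'' b1'' b2'' c1'' c2'' where l: "l = (((a1'', a2''), (b1'', b2'')), (c1'', c2''))" by (metis surj_pair)
  show "exp_za k g h + exp_za k (hmul k g h) l = exp_za k g (hmul k h l) + exp_za k h l"
    unfolding g h l by (simp add: binom2_add[OF assms] algebra_simps)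
  show "exp_bz k g h + exp_bz k (hmul k g h) l = exp_bz k g (hmul k h l) + exp_bz k h l"
    unfolding g h l by (simp add: binom2_add[OF assms] algebra_simps power2_eq_square)
qed

lemma binom2_0 [simp]: "binom2 0 = 0"
  by (simp add: binom2_def)

lemma exp_central:
  "exp_za k ((0, 0), c) ((a, b), d) = qmul k c a"
  "exp_za k ((a, b), d) ((0, 0), c) = 0"
  "exp_bz k ((0, 0), c) ((a, b), d) = 0"
  "exp_bz k ((a, b), d) ((0, 0), c) = - qmul k b c"
  by (cases a; cases b; cases c; cases d; simp add: zero_prod_def algebra_simps)+

definition std_cocycle :: "'p::prime_card mod_ring \<Rightarrow> (nat \<Rightarrow> complex) \<Rightarrow> 'p coords \<Rightarrow> 'p coords \<Rightarrow> complex" where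
  "std_cocycle k \<mu> g h =
     \<mu> 1 ^\<^sub>p exp_bilin 0 g h * \<mu> 2 ^\<^sub>p exp_bilin 1 g h * \<mu> 3 ^\<^sub>p exp_bilin 2 g h * \<mu> 4 ^\<^sub>p exp_bilin 3 g h *
     \<mu> 5 ^\<^sub>p fst (exp_za k g h) * \<mu> 6 ^\<^sub>p snd (exp_za k g h) *
     \<mu> 7 ^\<^sub>p fst (exp_bz k g h) * \<mu> 8 ^\<^sub>p snd (exp_bz k g h)"

text \<open>
  The central coordinates add up to the coordinates of $c + c' + b a'$, so the coboundary of a
  character of $c_1$ is that character at $b_1 a_1' + k b_2 a_2'$, and for $c_2$ it is the one at
  $b_1 a_2' + b_2 a_1'$.
\<close>

lemma cohom_central_coordinates:
  fixes k :: "'p::prime_card mod_ring"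
  assumes "\<mu> ^ CARD('p) = 1" "\<nu> ^ CARD('p) = 1"
  shows "cohom (hmul k) (\<lambda>g h. \<mu> ^\<^sub>p exp_bilin 4 g h * \<nu> ^\<^sub>p exp_bilin 5 g h)
     (\<lambda>g h. \<mu> ^\<^sub>p (- k * exp_bilin 2 g h) * \<nu> ^\<^sub>p (- exp_bilin 1 g h))"
proof -
  note \<mu> = character_fpow[OF assms(1)] and \<nu> = character_fpow[OF assms(2)]
  define u where "u g = \<mu> ^\<^sub>p fst (snd g) * \<nu> ^\<^sub>p snd (snd g)" for g :: "'p coords"
  have "\<mu> ^\<^sub>p exp_bilin 4 g h * \<nu> ^\<^sub>p exp_bilin 5 g h * (u g * u h) =
    \<mu> ^\<^sub>p (- k * exp_bilin 2 g h) * \<nu> ^\<^sub>p (- exp_bilin 1 g h) * u (hmul k g h)" for g h :: "'p coords"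
  proof -
    obtain a1 a2 b1 b2 c1 c2 where g: "g = (((a1, a2), (b1, b2)), (c1, c2))" by (metis surj_pair)
    obtain a1' a2' b1' b2' c1' c2' where h: "h = (((a1', a2'), (b1', b2')), (c1', c2'))" by (metis surj_pair)
    have "\<mu> ^\<^sub>p (b1 * a1' + c1 + c1') * \<nu> ^\<^sub>p (b1 * a2' + c2 + c2') =
       \<mu> ^\<^sub>p (- k * (b2 * a2') + (c1 + c1' + (b1 * a1' + k * b2 * a2'))) *
       \<nu> ^\<^sub>p (- (b2 * a1') + (c2 + c2' + (b1 * a2' + b2 * a1')))"
      by (intro arg_cong2[where f = "(*)"] arg_cong[where f = "\<lambda>x. _ ^\<^sub>p x"]) (simp_all add: algebra_simps)
    then show ?thesis
      unfolding g h u_def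
      by (simp only: H.heis_mult.simps qmul.simps exp_bilin.simps fst_conv snd_conv add_Pair
          character_add[OF \<mu>] character_add[OF \<nu>]) (simp add: mult_ac)
  qed
  then show ?thesis
    unfolding cohom_def
    using character_nonzero[OF \<mu>] character_nonzero[OF \<nu>] by (intro exI[of _ u]) (simp add: u_def)
qed

theorem heisenberg_cocycle_classification:
  fixes k :: "'p::prime_card mod_ring"
  assumes odd: "odd CARD('p)" and \<alpha>: "cocycle (hmul k) \<alpha>"
  obtains \<mu> where "\<And>i. i \<in> {1..8} \<Longrightarrow> \<mu> i ^ CARD('p) = 1" "cohom (hmul k) \<alpha> (std_cocycle k \<mu>)"
proof -
  obtain \<phi> \<psi> where \<phi>: "character \<phi>" and \<psi>: "character \<psi>"
    and \<chi>: "\<And>a b c d. comm_pairing \<alpha> ((0, 0), c) ((a, b), d) = \<phi> (qmul k c a) * \<psi> (qmul k b c)"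
    by (rule H.central_commutators[OF \<alpha>]) blast
  \<comment> \<open>A cocycle with the same central commutators as \<open>\<alpha>\<close>; the sign in \<open>exp_bz\<close> accounts for the
    central element standing on the right.\<close>
  define \<kappa> where "\<kappa> = (\<lambda>g h. \<phi> (exp_za k g h) * \<psi> (exp_bz k g h))"
  have "cocycle (hmul k) \<kappa>"
    unfolding \<kappa>_def
    by (intro cocycle_mult cocycle_character[OF \<phi>] cocycle_character[OF \<psi>] exp_cocycle odd)
  define \<alpha>' where "\<alpha>' = (\<lambda>g h. \<alpha> g h / \<kappa> g h)"
  have \<alpha>': "cocycle (hmul k) \<alpha>'"
    unfolding \<alpha>'_def by (rule cocycle_divide) fact+
  have symm: "\<alpha>' ((0, 0), c) g = \<alpha>' g ((0, 0), c)" for c g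
  proof -
    obtain a b d where g: "g = ((a, b), d)" by (metis surj_pair)
    have "\<alpha> ((0, 0), c) g = \<alpha> g ((0, 0), c) * (\<phi> (qmul k c a) * \<psi> (qmul k b c))"
      using \<chi>[of c a b d] cocycle_nonzero[OF \<alpha>] by (simp add: comm_pairing_def g field_simps)
    then show ?thesis
      using character_nonzero[OF \<phi>] character_nonzero[OF \<psi>]
      by (simp add: \<alpha>'_def \<kappa>_def g exp_central character_zero[OF \<phi>] character_zero[OF \<psi>]
          character_minus[OF \<psi>] divide_simps)
  qed
  have "cocycle (+) (\<lambda>c c'. \<alpha>' ((0, 0), c) ((0, 0), c'))"
    by (rule cocycle_pullback[OF \<alpha>']) simp
  then have "cohom (+) (\<lambda>c c'. \<alpha>' ((0, 0), c) ((0, 0), c')) (\<lambda>_ _. 1)"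
    using symm by (rule symmetric_cocycle_mod_ring_square_trivial)
  then obtain u where u: "\<And>c. u c \<noteq> 0"
    "\<And>c c'. \<alpha>' ((0, 0), c) ((0, 0), c') * (u c * u c') = u (c + c')"
    by (rule cohomE) auto
  obtain \<tau> where \<tau>: "cocycle (+) \<tau>" "cohom (hmul k) \<alpha>' (\<lambda>g h. \<tau> (fst g) (fst h))"
    using H.cohom_inflation[OF \<alpha>' symm u] by blast
  obtain \<mu> \<nu> :: complex and \<omega> :: "nat \<Rightarrow> nat \<Rightarrow> complex" where
    roots: "\<mu> ^ CARD('p) = 1" "\<nu> ^ CARD('p) = 1" "\<And>i j. \<omega> i j ^ CARD('p) = 1" and
    \<tau>': "cohom (+) \<tau> (\<lambda>((a1, a2), (b1, b2)) ((a1', a2'), (b1', b2')).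
       \<mu> ^\<^sub>p (a2 * a1') * \<nu> ^\<^sub>p (b2 * b1') *
       (\<omega> 1 1 ^\<^sub>p (b1 * a1') * \<omega> 1 2 ^\<^sub>p (b1 * a2') * \<omega> 2 1 ^\<^sub>p (b2 * a1') * \<omega> 2 2 ^\<^sub>p (b2 * a2')))"
    by (rule cocycle_mod_ring_fourth[OF \<tau>(1)]) (rule that)
  let ?\<rho> = "\<lambda>g h. \<omega> 1 1 ^\<^sub>p exp_bilin 4 g h * \<omega> 1 2 ^\<^sub>p exp_bilin 5 g h"
  let ?\<sigma> = "\<lambda>g h. \<mu> ^\<^sub>p exp_bilin 0 g h * \<nu> ^\<^sub>p exp_bilin 3 g h *
       (\<omega> 2 1 ^\<^sub>p exp_bilin 1 g h * \<omega> 2 2 ^\<^sub>p exp_bilin 2 g h) * \<kappa> g h"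
  have "cohom (hmul k) (\<lambda>g h. \<tau> (fst g) (fst h)) (\<lambda>g h.
      \<mu> ^\<^sub>p exp_bilin 0 g h * \<nu> ^\<^sub>p exp_bilin 3 g h *
      (?\<rho> g h * \<omega> 2 1 ^\<^sub>p exp_bilin 1 g h * \<omega> 2 2 ^\<^sub>p exp_bilin 2 g h))"
    by (rule cohom_cong_right[OF cohom_pullback[OF \<tau>', of fst "hmul k", OF H.fst_heis_mult]]) auto
  from cohom_mult[OF cohom_trans[OF \<tau>(2) this] cohom_refl[of _ \<kappa>]]
  have "cohom (hmul k) (\<lambda>g h. \<alpha>' g h * \<kappa> g h) (\<lambda>g h. ?\<rho> g h * ?\<sigma> g h)"
    by (simp only: mult_ac)
  moreover have "cohom (hmul k) (\<lambda>g h. ?\<rho> g h * ?\<sigma> g h) (\<lambda>g h.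
      \<omega> 1 1 ^\<^sub>p (- k * exp_bilin 2 g h) * \<omega> 1 2 ^\<^sub>p (- exp_bilin 1 g h) * ?\<sigma> g h)"
    by (intro cohom_mult cohom_central_coordinates roots cohom_refl)
  ultimately have "cohom (hmul k) (\<lambda>g h. \<alpha>' g h * \<kappa> g h) (\<lambda>g h.
      \<omega> 1 1 ^\<^sub>p (- k * exp_bilin 2 g h) * \<omega> 1 2 ^\<^sub>p (- exp_bilin 1 g h) * ?\<sigma> g h)"
    by (rule cohom_trans)
  moreover have "(\<lambda>g h. \<alpha>' g h * \<kappa> g h) = \<alpha>"
    using cocycle_nonzero[OF \<open>cocycle (hmul k) \<kappa>\<close>] by (simp add: \<alpha>'_def)
  \<comment> \<open>The second and third entry absorb the bilinear terms that were moved to $b_2 a_1'$ and $b_2 a_2'$.\<close>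
  moreover define M where "M i = [\<mu>, inverse (\<omega> 1 2) * \<omega> 2 1, (\<omega> 1 1 ^\<^sub>p (- k)) * \<omega> 2 2, \<nu>,
    \<phi> (1, 0), \<phi> (0, 1), \<psi> (1, 0), \<psi> (0, 1)] ! (i - 1)" for i
  have fpow_prod: "(x * y) ^\<^sub>p c = (x ^\<^sub>p c) * (y ^\<^sub>p c)" for x y and c :: "'p mod_ring"
    by (simp add: fpow_def power_mult_distrib)
  have inv: "\<omega> 1 2 ^\<^sub>p (- c) = inverse (\<omega> 1 2) ^\<^sub>p c" for c :: "'p mod_ring"
    by (simp only: character_minus[OF character_fpow[OF roots(3)]]) (simp add: fpow_def power_inverse)
  have \<kappa>: "\<kappa> g h = \<phi> (1, 0) ^\<^sub>p fst (exp_za k g h) * \<phi> (0, 1) ^\<^sub>p snd (exp_za k g h) *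
      (\<psi> (1, 0) ^\<^sub>p fst (exp_bz k g h) * \<psi> (0, 1) ^\<^sub>p snd (exp_bz k g h))" for g h
    using character_mod_ring_square(3)[OF \<phi>, of "fst (exp_za k g h)" "snd (exp_za k g h)"]
      character_mod_ring_square(3)[OF \<psi>, of "fst (exp_bz k g h)" "snd (exp_bz k g h)"]
    unfolding \<kappa>_def prod.collapse by (simp only:)
  have "\<omega> 1 1 ^\<^sub>p (- k * exp_bilin 2 g h) * \<omega> 1 2 ^\<^sub>p (- exp_bilin 1 g h) * ?\<sigma> g h
     = std_cocycle k M g h" for g h
    unfolding std_cocycle_def \<kappa> inv fpow_mult[OF roots(3)]
    by (simp add: M_def fpow_prod)
  then have "(\<lambda>g h. \<omega> 1 1 ^\<^sub>p (- k * exp_bilin 2 g h) * \<omega> 1 2 ^\<^sub>p (- exp_bilin 1 g h) * ?\<sigma> g h)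
     = std_cocycle k M"
    by (simp only:)
  ultimately have "cohom (hmul k) \<alpha> (std_cocycle k M)" by simp
  moreover have "M i ^ CARD('p) = 1" if "i \<in> {1..8}" for i
  proof -
    let ?L = "[\<mu>, inverse (\<omega> 1 2) * \<omega> 2 1, (\<omega> 1 1 ^\<^sub>p (- k)) * \<omega> 2 2, \<nu>,
      \<phi> (1, 0), \<phi> (0, 1), \<psi> (1, 0), \<psi> (0, 1)]"
    have "M i \<in> set ?L"
      unfolding M_def using that by (intro nth_mem) auto
    moreover have "\<forall>x\<in>set ?L. x ^ CARD('p) = 1"
      by (simp add: roots fpow_root power_mult_distrib power_inverse
          character_mod_ring_square(1,2)[OF \<phi>] character_mod_ring_square(1,2)[OF \<psi>])
    ultimately show ?thesis by blast
  qed
  ultimately show ?thesis using that by blast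
qed

section \<open>The matrix group over the quotient ring\<close>

lemma (in cring) mat_mult3_unitriangular:
  assumes "a \<in> carrier R" "b \<in> carrier R" "c \<in> carrier R"
    "a' \<in> carrier R" "b' \<in> carrier R" "c' \<in> carrier R"
  shows "mat_mult3 R (mat3 \<one> b c \<zero> \<one> a \<zero> \<zero> \<one>) (mat3 \<one> b' c' \<zero> \<one> a' \<zero> \<zero> \<one>) =
    mat3 \<one> (b \<oplus> b') (c \<oplus> c' \<oplus> b \<otimes> a') \<zero> \<one> (a \<oplus> a') \<zero> \<zero> \<one>"
proof (rule eq_matI)
  have three: "{..<3::nat} = {0, 1, 2}" by auto
  fix i j
  assume "i < dim_row (mat3 \<one> (b \<oplus> b') (c \<oplus> c' \<oplus> b \<otimes> a') \<zero> \<one> (a \<oplus> a') \<zero> \<zero> \<one>)"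
    "j < dim_col (mat3 \<one> (b \<oplus> b') (c \<oplus> c' \<oplus> b \<otimes> a') \<zero> \<one> (a \<oplus> a') \<zero> \<zero> \<one>)"
  then have "i \<in> {0, 1, 2}" "j \<in> {0, 1, 2}" by (auto simp: mat3_def)
  then show "mat_mult3 R (mat3 \<one> b c \<zero> \<one> a \<zero> \<zero> \<one>) (mat3 \<one> b' c' \<zero> \<one> a' \<zero> \<zero> \<one>) $$ (i, j) =
    mat3 \<one> (b \<oplus> b') (c \<oplus> c' \<oplus> b \<otimes> a') \<zero> \<one> (a \<oplus> a') \<zero> \<zero> \<one> $$ (i, j)"
    unfolding mat_mult3_def mat3_def three
    using assms by (auto simp: a_ac)
qed (simp_all add: mat_mult3_def mat3_def)

lemma (in cring) unitriangular3_iff: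
  "A \<in> unitriangular3 R \<longleftrightarrow> (\<exists>a b c. a \<in> carrier R \<and> b \<in> carrier R \<and> c \<in> carrier R \<and>
     A = mat3 \<one> b c \<zero> \<one> a \<zero> \<zero> \<one>)"
proof -
  have three: "i < 3 \<longleftrightarrow> i = 0 \<or> i = 1 \<or> i = 2" and two: "i < 2 \<longleftrightarrow> i = 0 \<or> i = 1"
    for i :: nat by auto
  have "A = mat3 \<one> (A $$ (0, 1)) (A $$ (0, 2)) \<zero> \<one> (A $$ (1, 2)) \<zero> \<zero> \<one>"
    if "A \<in> unitriangular3 R"
    using that by (intro eq_matI) (auto simp: unitriangular3_def mat3_def three)
  moreover have "A $$ (0, 1) \<in> carrier R" "A $$ (0, 2) \<in> carrier R" "A $$ (1, 2) \<in> carrier R"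
    if "A \<in> unitriangular3 R"
    using that by (auto simp: unitriangular3_def)
  moreover have "mat3 \<one> b c \<zero> \<one> a \<zero> \<zero> \<one> \<in> unitriangular3 R"
    if "a \<in> carrier R" "b \<in> carrier R" "c \<in> carrier R" for a b c
    using that by (auto simp: unitriangular3_def mat3_def three two)
  ultimately show ?thesis by blast
qed

lemma mat3_inject:
  assumes "mat3 x00 x01 x02 x10 x11 x12 x20 x21 x22 = mat3 y00 y01 y02 y10 y11 y12 y20 y21 y22"
  shows "x01 = y01" "x02 = y02" "x12 = y12"
proof -
  have "mat3 x00 x01 x02 x10 x11 x12 x20 x21 x22 $$ (i, j) = mat3 y00 y01 y02 y10 y11 y12 y20 y21 y22 $$ (i, j)"
    for i j
    using assms by simp
  from this[of 0 1] this[of 0 2] this[of 1 2]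
  show "x01 = y01" "x02 = y02" "x12 = y12" by (simp_all add: mat3_def)
qed

lemma cring_class_ring: "cring (class_ring :: 'a::comm_ring_1 ring)"
  by (rule class_cring.is_cring)

lemma ideal_quad_ideal: "ideal (quad_ideal k) class_ring"
  unfolding quad_ideal_def by (rule cring.cgenideal_ideal[OF cring_class_ring]) simp

lemma cring_quad_ring: "cring (quad_ring k)"
  unfolding quad_ring_def by (rule ideal.quotient_is_cring[OF ideal_quad_ideal cring_class_ring])

text \<open>
  Stated as divisibility, equality of cosets becomes a matter of polynomial division by $t^2 - k$.
\<close>

lemma coset_eq_iff:
  "quad_ideal k +>\<^bsub>class_ring\<^esub> f = quad_ideal k +>\<^bsub>class_ring\<^esub> g \<longleftrightarrow> [:- k, 0, 1:] dvd f - g"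
proof -
  have mem: "f \<in> quad_ideal k \<longleftrightarrow> [:- k, 0, 1:] dvd f" for f
    by (auto simp: quad_ideal_def cgenideal_def dvd_def mult.commute)
  have coset: "x \<in> quad_ideal k +>\<^bsub>class_ring\<^esub> f \<longleftrightarrow> [:- k, 0, 1:] dvd x - f" for x f
    by (auto simp: a_r_coset_def' mem intro: bexI[of _ "x - f"])
  show ?thesis
  proof
    assume "quad_ideal k +>\<^bsub>class_ring\<^esub> f = quad_ideal k +>\<^bsub>class_ring\<^esub> g"
    moreover have "f \<in> quad_ideal k +>\<^bsub>class_ring\<^esub> f" by (simp add: coset)
    ultimately show "[:- k, 0, 1:] dvd f - g" by (simp add: coset)
  next
    assume *: "[:- k, 0, 1:] dvd f - g"
    have "[:- k, 0, 1:] dvd x - f \<longleftrightarrow> [:- k, 0, 1:] dvd x - g" for x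
      using dvd_add_left_iff[OF *, of "x - f"] by simp
    then show "quad_ideal k +>\<^bsub>class_ring\<^esub> f = quad_ideal k +>\<^bsub>class_ring\<^esub> g"
      by (auto simp: coset)
  qed
qed

lemma quad_elt_inject: "quad_elt k r1 r2 = quad_elt k s1 s2 \<longleftrightarrow> r1 = s1 \<and> r2 = s2"
proof
  assume "quad_elt k r1 r2 = quad_elt k s1 s2"
  then have "[:- k, 0, 1:] dvd [:r1 - s1, r2 - s2:]"
    by (simp add: quad_elt_def coset_eq_iff)
  moreover have "degree [:r1 - s1, r2 - s2:] < degree [:- k, 0, 1:]" by simp
  ultimately have "[:r1 - s1, r2 - s2:] = 0"
    using dvd_imp_degree_le by (metis not_less)
  then show "r1 = s1 \<and> r2 = s2" by simp
qed simp

lemma carrier_quad_ring: "x \<in> carrier (quad_ring k) \<longleftrightarrow> (\<exists>r1 r2. x = quad_elt k r1 r2)"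
proof
  assume "x \<in> carrier (quad_ring k)"
  then obtain f where f: "x = quad_ideal k +>\<^bsub>class_ring\<^esub> f"
    by (auto simp: quad_ring_def FactRing_def A_RCOSETS_def')
  obtain r1 r2 where r: "f mod [:- k, 0, 1:] = [:r1, r2:]"
  proof -
    have "degree (f mod [:- k, 0, 1:]) < 2"
      using degree_mod_less[of "[:- k, 0, 1:]" f] by auto
    then have "f mod [:- k, 0, 1:] = [:poly.coeff (f mod [:- k, 0, 1:]) 0, poly.coeff (f mod [:- k, 0, 1:]) 1:]"
      by (intro poly_eqI) (auto simp: coeff_pCons coeff_eq_0 split: nat.split)
    then show thesis by (rule that)
  qed
  have "[:- k, 0, 1:] dvd f - f mod [:- k, 0, 1:]" by (rule dvd_minus_mod)
  then have "x = quad_elt k r1 r2" by (simp add: f quad_elt_def coset_eq_iff r)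
  then show "\<exists>r1 r2. x = quad_elt k r1 r2" by blast
qed (auto simp: quad_elt_def quad_ring_def FactRing_def A_RCOSETS_def')

lemma quad_ring_ops:
  "quad_elt k r1 r2 \<oplus>\<^bsub>quad_ring k\<^esub> quad_elt k s1 s2 = quad_elt k (r1 + s1) (r2 + s2)"
  "quad_elt k r1 r2 \<otimes>\<^bsub>quad_ring k\<^esub> quad_elt k s1 s2
     = quad_elt k (r1 * s1 + k * r2 * s2) (r1 * s2 + r2 * s1)"
  "\<zero>\<^bsub>quad_ring k\<^esub> = quad_elt k 0 0"
  "\<one>\<^bsub>quad_ring k\<^esub> = quad_elt k 1 0"
proof -
  interpret I: ideal "quad_ideal k" class_ring by (rule ideal_quad_ideal)
  show "quad_elt k r1 r2 \<oplus>\<^bsub>quad_ring k\<^esub> quad_elt k s1 s2 = quad_elt k (r1 + s1) (r2 + s2)"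
    using I.a_rcos_sum[of "[:r1, r2:]" "[:s1, s2:]"]
    by (simp add: quad_elt_def quad_ring_def FactRing_def)
  have "quad_elt k r1 r2 \<otimes>\<^bsub>quad_ring k\<^esub> quad_elt k s1 s2
      = quad_ideal k +>\<^bsub>class_ring\<^esub> ([:r1, r2:] * [:s1, s2:])"
    using I.rcoset_mult_add[of "[:r1, r2:]" "[:s1, s2:]"]
    by (simp add: quad_elt_def quad_ring_def FactRing_def)
  also have "\<dots> = quad_elt k (r1 * s1 + k * r2 * s2) (r1 * s2 + r2 * s1)"
    unfolding quad_elt_def coset_eq_iff by (intro dvdI[of _ _ "[:r2 * s2:]"]) (simp add: algebra_simps)
  finally show "quad_elt k r1 r2 \<otimes>\<^bsub>quad_ring k\<^esub> quad_elt k s1 s2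
     = quad_elt k (r1 * s1 + k * r2 * s2) (r1 * s2 + r2 * s1)" .
  show "\<zero>\<^bsub>quad_ring k\<^esub> = quad_elt k 0 0"
    by (simp add: quad_elt_def quad_ring_def FactRing_def a_r_coset_def')
  show "\<one>\<^bsub>quad_ring k\<^esub> = quad_elt k 1 0"
    by (simp add: quad_elt_def quad_ring_def FactRing_def one_pCons)
qed

fun heis_of :: "'p::prime_card mod_ring \<Rightarrow> 'p coords \<Rightarrow> 'p mod_ring poly set mat" where
  "heis_of k (((a1, a2), (b1, b2)), (c1, c2)) = heis_elt k a1 a2 b1 b2 c1 c2"

lemma inj_heis_of: "inj (heis_of k)"
proof (rule injI)
  fix g h assume eq: "heis_of k g = heis_of k h"
  obtain a1 a2 b1 b2 c1 c2 where g: "g = (((a1, a2), (b1, b2)), (c1, c2))" by (metis surj_pair)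
  obtain a1' a2' b1' b2' c1' c2' where h: "h = (((a1', a2'), (b1', b2')), (c1', c2'))" by (metis surj_pair)
  show "g = h"
    using mat3_inject[OF eq[unfolded g h heis_of.simps heis_elt_def]]
    by (simp add: g h quad_elt_inject)
qed

lemma range_heis_of: "range (heis_of k) = carrier (heisenberg (quad_ring k))"
proof -
  have "A \<in> range (heis_of k) \<longleftrightarrow> (\<exists>a1 a2 b1 b2 c1 c2. A = heis_elt k a1 a2 b1 b2 c1 c2)" for A
    by (auto simp: image_iff)
  then show ?thesis
    by (auto simp: heisenberg_def cring.unitriangular3_iff[OF cring_quad_ring] carrier_quad_ring
        heis_elt_def quad_ring_ops) blast+
qed

lemma heis_of_hmul: "heis_of k (hmul k g h) = heis_of k g \<otimes>\<^bsub>heisenberg (quad_ring k)\<^esub> heis_of k h"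
proof -
  obtain a1 a2 b1 b2 c1 c2 where g: "g = (((a1, a2), (b1, b2)), (c1, c2))" by (metis surj_pair)
  obtain a1' a2' b1' b2' c1' c2' where h: "h = (((a1', a2'), (b1', b2')), (c1', c2'))" by (metis surj_pair)
  have "quad_elt k r s \<in> carrier (quad_ring k)" for r s by (auto simp: carrier_quad_ring)
  then show ?thesis
    using cring.mat_mult3_unitriangular[OF cring_quad_ring, of "quad_elt k a1 a2" k "quad_elt k b1 b2"
      "quad_elt k c1 c2" "quad_elt k a1' a2'" "quad_elt k b1' b2'" "quad_elt k c1' c2'"]
    by (simp add: g h heisenberg_def heis_elt_def quad_ring_ops)
qed

theorem theorem5p1:
  fixes k :: "'p::prime_card mod_ring"
    and \<alpha> :: "'p mod_ring poly set mat \<Rightarrow> 'p mod_ring poly set mat \<Rightarrow> complex"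
  assumes odd_p: "odd CARD('p)"
    and nonsquare: "\<not> (\<exists>s. s ^ 2 = k)"
    and cocycle: "two_cocycle (heisenberg (quad_ring k)) \<alpha>"
  shows "\<exists>(\<mu> :: nat \<Rightarrow> complex) \<beta>.
    (\<forall>i\<in>{1..8}. \<mu> i ^ CARD('p) = 1) \<and>
    cohomologous (heisenberg (quad_ring k)) \<alpha> \<beta> \<and>
    (\<forall>a1 a2 b1 b2 c1 c2 a1' a2' b1' b2' c1' c2'.
       \<beta> (heis_elt k a1 a2 b1 b2 c1 c2) (heis_elt k a1' a2' b1' b2' c1' c2') =
         \<mu> 1 ^\<^sub>p (a2 * a1') * \<mu> 2 ^\<^sub>p (b2 * a1') * \<mu> 3 ^\<^sub>p (b2 * a2') * \<mu> 4 ^\<^sub>p (b2 * b1') *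
         \<mu> 5 ^\<^sub>p (b1 * binom2 a1' + k * b1 * binom2 a2' + k * b2 * a1' * a2'
                   + a1' * c1 + k * a2' * c2) *
         \<mu> 6 ^\<^sub>p (b2 * binom2 a1' + k * b2 * binom2 a2' + b1 * a1' * a2'
                   + a1' * c2 + a2' * c1) *
         \<mu> 7 ^\<^sub>p (a1' * binom2 b1 + k * a1' * binom2 b2 - b1 ^ 2 * a1'
                   - b1 * c1' - k * b2 * c2'
                   - k * b2 ^ 2 * a1' - k * b1 * b2 * a2') *
         \<mu> 8 ^\<^sub>p (a2' * binom2 b1 + k * a2' * binom2 b2 - k * b2 ^ 2 * a2'
                   - b2 * c1' - b1 * c2'
                   - b1 ^ 2 * a2' - b1 * b2 * a1'))"
proof -
  let ?G = "heisenberg (quad_ring k)" and ?h = "heis_of k"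
  have mem: "x \<in> carrier ?G \<longleftrightarrow> (\<exists>g. x = ?h g)" for x
    unfolding range_heis_of[symmetric] image_iff by simp
  then have carr: "?h g \<in> carrier ?G" for g by blast
  have "cocycle (hmul k) (\<lambda>g h. \<alpha> (?h g) (?h h))"
    using cocycle carr unfolding two_cocycle_def cocycle_def heis_of_hmul by blast
  then obtain \<mu> where \<mu>: "\<And>i. i \<in> {1..8} \<Longrightarrow> \<mu> i ^ CARD('p) = 1"
    and coh: "cohom (hmul k) (\<lambda>g h. \<alpha> (?h g) (?h h)) (std_cocycle k \<mu>)"
    by (rule heisenberg_cocycle_classification[OF odd_p]) (rule that)
  obtain u where u: "\<And>g. u g \<noteq> 0"
    "\<And>g h. \<alpha> (?h g) (?h h) * (u g * u h) = std_cocycle k \<mu> g h * u (hmul k g h)"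
    by (rule cohomE[OF coh]) (rule that)
  define d where "d = inv_into UNIV ?h"
  have d: "d (?h g) = g" for g unfolding d_def by (rule inv_f_f[OF inj_heis_of])
  define \<beta> where "\<beta> x y = std_cocycle k \<mu> (d x) (d y)" for x y
  \<comment> \<open>The inverse appears because \<open>cohom\<close> has the coboundary of \<open>u\<close> on the side of \<open>\<alpha>\<close>, and
    \<open>cohomologous\<close> has it on the other side.\<close>
  define \<delta> where "\<delta> x y = inverse (u (d x)) * inverse (u (d y)) / inverse (u (d (x \<otimes>\<^bsub>?G\<^esub> y)))" for x y
  have "two_coboundary ?G \<delta>"
    unfolding two_coboundary_def \<delta>_def using u(1) by (intro exI[of _ "\<lambda>x. inverse (u (d x))"]) simp
  moreover have "\<alpha> x y = \<beta> x y * \<delta> x y" if "x \<in> carrier ?G" "y \<in> carrier ?G" for x y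
  proof -
    obtain g where x: "x = ?h g" using \<open>x \<in> carrier ?G\<close> mem[of x] by blast
    obtain h where y: "y = ?h h" using \<open>y \<in> carrier ?G\<close> mem[of y] by blast
    show ?thesis
      using u(2)[of g h] u(1)
      unfolding x y \<beta>_def \<delta>_def heis_of_hmul[symmetric] d by (simp add: divide_simps)
  qed
  ultimately have "cohomologous ?G \<alpha> \<beta>" unfolding cohomologous_def by blast
  moreover have "\<beta> (heis_elt k a1 a2 b1 b2 c1 c2) (heis_elt k a1' a2' b1' b2' c1' c2')
      = std_cocycle k \<mu> (((a1, a2), (b1, b2)), (c1, c2)) (((a1', a2'), (b1', b2')), (c1', c2'))"
    for a1 a2 b1 b2 c1 c2 a1' a2' b1' b2' c1' c2'
    by (simp add: \<beta>_def d flip: heis_of.simps)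
  ultimately show ?thesis
    using \<mu> by (intro exI[of _ \<mu>] exI[of _ \<beta>]) (simp add: std_cocycle_def)
qed

end
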